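(* Let $k\ge2$ be an integer, let $g_0\in\mathcal D_k$ and let $x_0$ be a fixed point in $(0,\infty)$ such that $g_0$ is $k$ times differentiable at $x_0$. For $j\in\{0,\dots,k-1\}$, an asymptotic lower bound for the local minimax risk of any estimator $\hat T_{n,j}$ for estimating the functional $T_jg_0=g_0^{(j)}(x_0)$ is given by $$\sup_{\tau>0}\liminf_{n\to\infty}n^{\frac{k-j}{2k+1}}MMR_1(n,T_j,\mathcal D_{k,n,\tau})\ \ge\ \Big\{|g_0^{(k)}(x_0)|^{2j+1}g_0(x_0)^{k-j}\Big\}^{1/(2k+1)}d_{k,j},$$ where $d_{k,j}>0$, $j\in\{0,\dots,k-1\}$, is given by $$d_{k,j}=\frac14\Big(4\,\frac{k-j}{2k+1}e^{-1}\Big)^{\frac{k-j}{2k+1}}\frac{\lambda_{k,1}^{(j)}}{(\lambda_{k,2})^{\frac{k-j}{2k+1}}},$$ with $$\lambda_{k,2}=2^{4(k+1)}\,\frac{(2k+3)(k+2)}{(k+1)^2}\,\frac{\big((2(k+1))!\big)^2}{(4k+7)!\,((k-1)!)^2\binom{k}{k/2-1}^2}\quad\text{when }k\text{ is even},$$ $$\lambda_{k,2}=2^{4(k+2)}(2k+3)(k+2)\,\frac{\big((2(k+1))!\big)^2}{(4k+7)!\,(k!)^2\binom{k+1}{(k-1)/2}^2}\quad\text{when }k\text{ is odd},$$ and, with $r(x)=(1-x^2)^{k+1}(1+x)$ for $-1\le x\le1$ and $C_{k,j}=r^{(j)}(0)$, $$\lambda_{k,1}^{(j)}=\left|\frac{C_{k,j}}{C_{k,k}}\right|,\qquad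 0\le j\le k-1.$$
   Context: For $k\ge2$, a function $g$ on $(0,\infty)$ is $k$-monotone if $(-1)^l g^{(l)}$ is nonnegative, nonincreasing and convex for $l=0,\dots,k-2$; $\mathcal D_k$ is the class of $k$-monotone probability densities on $(0,\infty)$. For a real-valued functional $T$ of $g$ and a subset $\mathcal D\subset\mathcal D_k$, the $L_1$-minimax risk based on a sample $X_1,\dots,X_n$ of size $n$ (i.i.d. with density $g$ under $E_g$) is $$MMR_1(n,T,\mathcal D)=\inf_{t_n}\sup_{g\in\mathcal D}E_g|\hat T_n-Tg|,$$ where the infimum ranges over all measurable functions $t_n:\mathbb R^n\to\mathbb R$ and $\hat T_n=t_n(X_1,\dots,X_n)$. For $\tau>0$, $\mathcal D_{k,n,\tau}$ is the Hellinger ball $\{g\in\mathcal D_k:\ H^2(g,g_0)=\frac12\int_0^\infty(\sqrt{g(x)}-\sqrt{g_0(x)})^2dx\le\tau/n\}$. The functional $T_j$ is $T_jg=g^{(j)}(x_0)$. *)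

theory Defs
  imports "HOL-Probability.Probability"
begin

text \<open>
  Functions on the positive half-line are represented by functions of type
  \<^typ>\<open>real \<Rightarrow> real\<close> of which only the values on \<^term>\<open>{0::real<..}\<close> matter; since this set is
  open, the iterated derivative \<^term>\<open>(deriv ^^ l) g x\<close> at a positive \<^term>\<open>x\<close> depends on those
  values only.  As \<^const>\<open>deriv\<close> is a total operator, existence of derivatives is always
  required separately.
\<close>

definition k_monotone :: "nat \<Rightarrow> (real \<Rightarrow> real) \<Rightarrow> bool" where
  "k_monotone k g \<longleftrightarrow>
     (\<forall>l<k - 2. \<forall>x>0. (deriv ^^ l) g differentiable (at x)) \<and>
     (\<forall>l\<le>k - 2.
        (\<forall>x>0. 0 \<le> (-1) ^ l * (deriv ^^ l) g x) \<and>
        antimono_on {0<..} (\<lambda>x. (-1) ^ l * (deriv ^^ l) g x) \<and>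
        convex_on {0<..} (\<lambda>x. (-1) ^ l * (deriv ^^ l) g x))"

definition k_monotone_densities :: "nat \<Rightarrow> (real \<Rightarrow> real) set" where
  "k_monotone_densities k =
     {g. k_monotone k g \<and> (\<integral>\<^sup>+x\<in>{0<..}. ennreal (g x) \<partial>lborel) = 1}"

text \<open>
  Differentiability of order \<^term>\<open>m\<close> at a point in the usual sense: the derivatives of order less
  than \<^term>\<open>m\<close> exist near \<^term>\<open>x\<close>, and the one of order \<^term>\<open>m - 1\<close> is differentiable at \<^term>\<open>x\<close>.
\<close>

primrec times_differentiable_at :: "nat \<Rightarrow> (real \<Rightarrow> real) \<Rightarrow> real \<Rightarrow> bool" where
  "times_differentiable_at 0 g x \<longleftrightarrow> True"
| "times_differentiable_at (Suc m) g x \<longleftrightarrow>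
     (\<forall>\<^sub>F y in nhds x. times_differentiable_at m g y) \<and> (deriv ^^ m) g differentiable (at x)"

definition density_law :: "(real \<Rightarrow> real) \<Rightarrow> real measure" where
  "density_law g = density lborel (\<lambda>x. ennreal (g x) * indicator {0<..} x)"

definition sample_law :: "nat \<Rightarrow> (real \<Rightarrow> real) \<Rightarrow> (nat \<Rightarrow> real) measure" where
  "sample_law n g = (\<Pi>\<^sub>M i\<in>{..<n}. density_law g)"

definition minimax_risk_L1 ::
    "nat \<Rightarrow> ((real \<Rightarrow> real) \<Rightarrow> real) \<Rightarrow> (real \<Rightarrow> real) set \<Rightarrow> ennreal" where
  "minimax_risk_L1 n T D =
     (INF t \<in> borel_measurable (\<Pi>\<^sub>M i\<in>{..<n}. (borel :: real measure)).
        SUP g\<in>D. \<integral>\<^sup>+X. ennreal \<bar>t X - T g\<bar> \<partial>sample_law n g)"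

definition hellinger_sq :: "(real \<Rightarrow> real) \<Rightarrow> (real \<Rightarrow> real) \<Rightarrow> real" where
  "hellinger_sq g h = 1 / 2 * (LINT x:{0<..}|lborel. (sqrt (g x) - sqrt (h x))\<^sup>2)"

definition hellinger_ball :: "nat \<Rightarrow> (real \<Rightarrow> real) \<Rightarrow> nat \<Rightarrow> real \<Rightarrow> (real \<Rightarrow> real) set" where
  "hellinger_ball k g0 n \<tau> = {g \<in> k_monotone_densities k. hellinger_sq g g0 \<le> \<tau> / real n}"

definition derivative_functional :: "nat \<Rightarrow> real \<Rightarrow> (real \<Rightarrow> real) \<Rightarrow> real" where
  "derivative_functional j x0 g = (deriv ^^ j) g x0"

text \<open>
  For \<^term>\<open>j = k - 1\<close> the derivative of order \<^term>\<open>j\<close> at \<^term>\<open>x0\<close> need not exist for every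
  \<^term>\<open>k\<close>-monotone \<^term>\<open>g\<close>, so the functional is real-valued only on the following set (which
  contains all \<^term>\<open>k\<close>-monotone functions when \<^term>\<open>j \<le> k - 2\<close> and \<^term>\<open>0 < x0\<close>).  Restricting
  the supremum in the risk to this set can only decrease it, so a lower bound for the restricted
  risk holds under any convention for the functional at the remaining functions.
\<close>

definition derivative_functional_domain :: "nat \<Rightarrow> real \<Rightarrow> (real \<Rightarrow> real) set" where
  "derivative_functional_domain j x0 = {g. times_differentiable_at j g x0}"

definition perturbation :: "nat \<Rightarrow> real \<Rightarrow> real" where
  "perturbation k x = (1 - x\<^sup>2) ^ (k + 1) * (1 + x)"

definition C_const :: "nat \<Rightarrow> nat \<Rightarrow> real" where
  "C_const k j = (deriv ^^ j) (perturbation k) 0"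

definition lambda1 :: "nat \<Rightarrow> nat \<Rightarrow> real" where
  "lambda1 k j = \<bar>C_const k j / C_const k k\<bar>"

definition lambda2 :: "nat \<Rightarrow> real" where
  "lambda2 k =
     (if even k then
        2 ^ (4 * (k + 1)) * (real ((2 * k + 3) * (k + 2)) / (real (k + 1))\<^sup>2)
          * ((fact (2 * (k + 1)))\<^sup>2
             / (fact (4 * k + 7) * (fact (k - 1))\<^sup>2 * (real (k choose (k div 2 - 1)))\<^sup>2))
      else
        2 ^ (4 * (k + 2)) * real ((2 * k + 3) * (k + 2))
          * ((fact (2 * (k + 1)))\<^sup>2
             / (fact (4 * k + 7) * (fact k)\<^sup>2 * (real ((k + 1) choose ((k - 1) div 2)))\<^sup>2)))"

definition rate_exponent :: "nat \<Rightarrow> nat \<Rightarrow> real" where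
  "rate_exponent k j = (real k - real j) / (2 * real k + 1)"

definition d_const :: "nat \<Rightarrow> nat \<Rightarrow> real" where
  "d_const k j =
     1 / 4 * (4 * rate_exponent k j * exp (-1)) powr rate_exponent k j
       * (lambda1 k j / lambda2 k powr rate_exponent k j)"

end

theory Submission
  imports Defs
begin

text \<open>
  The right-hand side vanishes unless \<open>g0 x0\<close> and the \<open>k\<close>-th derivative of \<open>g0\<close> at \<open>x0\<close> are both
  nonzero.  In that case the supremum over \<open>\<tau>\<close> is infinite, because it is taken after the limit:
  a Hellinger ball of radius \<open>\<tau> / n\<close> with large \<open>\<tau>\<close> contains densities which, on a window of the
  critical width \<open>n powr (- 1 / (2 * k + 1))\<close> around \<open>x0\<close>, have a \<open>k\<close>-th derivative many times larger
  than that of \<open>g0\<close>.  The local risk grows like the power \<open>(2 * j + 1) / (2 * k + 1)\<close> of that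
  derivative, so it exceeds every constant (\<open>minimax_risk_unbounded\<close>); in particular it exceeds the
  one in the theorem.

  The alternatives are obtained by changing \<open>g0\<close> on \<open>{x0 - \<mu>..x0 + \<mu>}\<close> only.  Two difficulties have
  to be met there.  First, the \<open>k\<close>-th derivative of \<open>g0\<close> is known at the single point \<open>x0\<close>, so adding
  a smooth bump to \<open>g0\<close> may destroy convexity next to \<open>x0\<close>.  Therefore \<open>g0\<close> is first replaced on the
  window by a polynomial, namely its Taylor polynomial plus a Hermite interpolation term which
  restores the derivatives of order below \<open>k\<close> at both ends as well as the total mass
  (\<open>hermite_correction\<close>); that term is small because the Taylor remainders of all these derivatives
  are small (\<open>taylor_remainder\<close>).  After the replacement the \<open>k\<close>-th derivative is, up to its sign, at
  least half of its value at \<open>x0\<close> throughout the window, and \<open>k\<close>-monotonicity of the glued function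
  reduces to convexity of its derivative of order \<open>k - 2\<close> (\<open>k_monotone_replace\<close>).

  Second, a single bump of given shape can raise the \<open>k\<close>-th derivative at \<open>x0\<close> only by a bounded
  factor, since it lowers it elsewhere.  But it raises it by some factor \<open>\<theta> > 1\<close> on a whole smaller
  interval, and the same bump scaled into that interval raises it by \<open>\<theta>\<close> once more.
  Nesting \<open>N\<close> bumps in this way gives the factor \<open>\<theta> ^ N\<close> while the \<open>k\<close>-th derivative keeps its
  sign everywhere (\<open>spike_sum_nonneg\<close>).

  The densities \<open>f\<close> and \<open>g\<close> with \<open>N\<close> and \<open>N + 1\<close> nested bumps (\<open>two_local_alternatives\<close>) differ by the
  innermost bump only.  The window is chosen so that their chi-square distance is at most
  \<open>1 / (2 * n)\<close>; samples of size \<open>n\<close> cannot reliably tell them apart, and the risk is at least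
  a quarter of the difference of the two values of the functional (\<open>minimax_risk_L1_two_points\<close>).
  Multiplied by the rate this is a constant times a power of \<open>\<theta> ^ N\<close> with positive exponent.
\<close>

section \<open>Higher derivatives of functions given piecewise\<close>

text \<open>
  The iterated \<^const>\<open>deriv\<close> is a total operator and says nothing about differentiability.  A
  family \<open>D\<close> of successive derivatives on an open set determines it there, and all later
  constructions supply such a family.
\<close>
lemma higher_deriv_eqI:
  fixes D :: "nat \<Rightarrow> real \<Rightarrow> real"
  assumes "open S" and "\<And>x. x \<in> S \<Longrightarrow> g x = D 0 x"
    and "\<And>l x. l < m \<Longrightarrow> x \<in> S \<Longrightarrow> (D l has_real_derivative D (Suc l) x) (at x)"
    and "l \<le> m" "x \<in> S"
  shows "(deriv ^^ l) g x = D l x"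
  using assms(4,5)
proof (induction l arbitrary: x)
  case 0
  then show ?case using assms(2) by simp
next
  case (Suc l)
  have "\<forall>\<^sub>F y in nhds x. (deriv ^^ l) g y = D l y"
    using Suc eventually_nhds_in_open[OF assms(1) Suc.prems(2)] by (auto elim: eventually_mono)
  then have "deriv ((deriv ^^ l) g) x = deriv (D l) x"
    by (intro deriv_cong_ev) auto
  also have "\<dots> = D (Suc l) x"
    using Suc.prems assms(3) by (intro DERIV_imp_deriv) auto
  finally show ?case by simp
qed

lemma higher_deriv_differentiableI:
  fixes D :: "nat \<Rightarrow> real \<Rightarrow> real"
  assumes "open S" and "\<And>x. x \<in> S \<Longrightarrow> g x = D 0 x"
    and "\<And>l x. l < m \<Longrightarrow> x \<in> S \<Longrightarrow> (D l has_real_derivative D (Suc l) x) (at x)"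
    and "l < m" "x \<in> S"
  shows "((deriv ^^ l) g has_real_derivative D (Suc l) x) (at x)"
proof -
  have "\<forall>\<^sub>F y in nhds x. (deriv ^^ l) g y = D l y"
    using higher_deriv_eqI[OF assms(1-3)] assms(4) eventually_nhds_in_open[OF assms(1,5)]
    by (auto elim: eventually_mono)
  then show ?thesis
    using assms(3)[OF assms(4,5)] DERIV_cong_ev[of x x "(deriv ^^ l) g" "D l"] by auto
qed

lemma times_differentiable_atI:
  assumes "open S" and "\<And>l x. l < m \<Longrightarrow> x \<in> S \<Longrightarrow> (deriv ^^ l) g differentiable (at x)"
    and "x \<in> S"
  shows "times_differentiable_at m g x"
  using assms(2,3)
proof (induction m arbitrary: x)
  case (Suc m)
  then show ?case
    using eventually_nhds_in_open[OF assms(1) Suc.prems(2)] by (auto elim: eventually_mono)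
qed simp

lemma times_differentiable_atD:
  assumes "times_differentiable_at m g x" "l < m"
  shows "(deriv ^^ l) g differentiable (at x)"
  using assms
proof (induction m arbitrary: x)
  case (Suc m)
  then show ?case
    using eventually_nhds_x_imp_x[of "\<lambda>y. times_differentiable_at m g y" x] 
    by (auto simp: less_Suc_eq)
qed simp

lemma DERIV_glue:
  fixes u v :: "real \<Rightarrow> real"
  assumes "x \<le> c \<Longrightarrow> (u has_real_derivative D) (at x)"
    and "x \<ge> c \<Longrightarrow> (v has_real_derivative D) (at x)" and "u c = v c"
  shows "((\<lambda>y. if y \<le> c then u y else v y) has_real_derivative D) (at x)"
proof -
  let ?w = "\<lambda>y. if y \<le> c then u y else v y"
  consider "x < c" | "x > c" | "x = c" by linarith
  then show ?thesis
  proof cases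
    case 1
    have "\<forall>\<^sub>F y in nhds x. ?w y = u y"
      using eventually_nhds_in_open[of "{..<c}" x] 1 by (auto elim!: eventually_mono)
    then show ?thesis using DERIV_cong_ev[of x x ?w u] assms(1) 1 by auto
  next
    case 2
    have "\<forall>\<^sub>F y in nhds x. ?w y = v y"
      using eventually_nhds_in_open[of "{c<..}" x] 2 by (auto elim!: eventually_mono)
    then show ?thesis using DERIV_cong_ev[of x x ?w v] assms(2) 2 by auto
  next
    case 3
    have l: "(?w has_real_derivative D) (at c within {..c})"
    proof (rule has_field_derivative_transform_within[where d=1 and f=u])
      show "(u has_real_derivative D) (at c within {..c})"
        using assms(1) 3 by (auto intro: has_field_derivative_at_within)
    qed (use assms(3) in auto)
    have r: "(?w has_real_derivative D) (at c within {c..})"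
    proof (rule has_field_derivative_transform_within[where d=1 and f=v])
      show "(v has_real_derivative D) (at c within {c..})"
        using assms(2) 3 by (auto intro: has_field_derivative_at_within)
    qed (use assms(3) in auto)
    have "(?w has_real_derivative D) (at c within {..c} \<union> {c..})"
      using l r unfolding has_field_derivative_iff Lim_within_Un by simp
    moreover have "{..c} \<union> {c..} = UNIV" by auto
    ultimately show ?thesis using 3 by simp
  qed
qed

text \<open>
  Two functions that agree at \<open>p\<close> and \<open>q\<close> to first order can be glued there; applied to successive
  derivatives this makes a piecewise function as smooth as its contact at the end points.
\<close>
lemma DERIV_glue_interval:
  fixes u v :: "real \<Rightarrow> real"
  assumes "p \<le> q" "x \<in> {p..q} \<Longrightarrow> (u has_real_derivative D) (at x)"
    and "x \<notin> {p<..<q} \<Longrightarrow> (v has_real_derivative D) (at x)" and "u p = v p" "u q = v q"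
  shows "((\<lambda>y. if y \<in> {p..q} then u y else v y) has_real_derivative D) (at x)"
proof -
  have 1: "((\<lambda>y. if y \<le> q then u y else v y) has_real_derivative D) (at x)" if "x \<ge> p"
    using that assms by (intro DERIV_glue) auto
  have "((\<lambda>y. if y \<le> p then v y else (if y \<le> q then u y else v y)) has_real_derivative D) (at x)"
    using assms 1 by (intro DERIV_glue) auto
  also have "(\<lambda>y. if y \<le> p then v y else (if y \<le> q then u y else v y))
     = (\<lambda>y. if y \<in> {p..q} then u y else v y)"
    using assms by (auto simp: fun_eq_iff)
  finally show ?thesis .
qed

section \<open>Replacing a k-monotone density on an interval\<close>

text \<open>
  A convex function may be changed on \<open>{p..q}\<close> to another one that lies above its own tangents there,
  as long as the slopes at \<open>p\<close> and \<open>q\<close> are slopes of supporting lines of the old function: the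
  supporting lines inside and outside are then ordered by slope, so each of them stays below the
  glued function on all three pieces.
\<close>
lemma convex_on_replace:
  fixes f h d :: "real \<Rightarrow> real"
  assumes f: "convex_on {0<..} f" and "0 < p" "p \<le> q"
    and h: "\<And>y. y > 0 \<Longrightarrow> y \<notin> {p<..<q} \<Longrightarrow> h y = f y"
    and tp: "\<And>y. y > 0 \<Longrightarrow> f p + d p * (y - p) \<le> f y"
    and tq: "\<And>y. y > 0 \<Longrightarrow> f q + d q * (y - q) \<le> f y"
    and tan: "\<And>x y. x \<in> {p..q} \<Longrightarrow> y \<in> {p..q} \<Longrightarrow> h x + d x * (y - x) \<le> h y"
  shows "convex_on {0<..} h"
proof -
  \<comment> \<open>slope of a supporting line of \<open>f\<close> at \<open>x\<close>\<close>
  define s where "s x = Inf ((\<lambda>t. (f x - f t) / (x - t)) ` ({x<..} \<inter> {0<..}))" for x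
  have s: "f x + s x * (y - x) \<le> f y" if "x > 0" "y > 0" for x y
    unfolding s_def using convex_le_Inf_differential[OF f, of x y] that
    by (simp add: interior_open)
  have hp: "h p = f p" and hq: "h q = f q" using h assms(2,3) by auto
  have dmono: "d x \<le> d y" if "x \<in> {p..q}" "y \<in> {p..q}" "x < y" for x y
  proof -
    have "(d y - d x) * (y - x) \<ge> 0"
      using tan[of x y] tan[of y x] that by (simp add: algebra_simps)
    then show ?thesis using that by (simp add: zero_le_mult_iff)
  qed
  define e where "e x = (if x \<in> {p..q} then d x else s x)" for x
  show ?thesis
  proof (rule pos_convex_function)
    fix x y :: real assume "x \<in> {0<..}" "y \<in> {0<..}"
    then have x: "x > 0" and y: "y > 0" by auto
    have "h x + e x * (y - x) \<le> h y"
    proof (cases "x \<in> {p..q}")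
      case True
      consider "y \<in> {p..q}" | "y > q" | "y < p" by force
      then show ?thesis
      proof cases
        case 1 then show ?thesis using tan True by (simp add: e_def)
      next
        case 2
        have "h x + d x * (q - x) \<le> f q" using tan[of x q] True assms(3) hq by auto
        moreover have "f q + d q * (y - q) \<le> h y" using tq[OF y] h[OF y] 2 by auto
        moreover have "d x * (y - q) \<le> d q * (y - q)"
          using dmono[of x q] True 2 assms(3) by (cases "x = q") (auto intro!: mult_right_mono)
        ultimately show ?thesis using True by (simp add: e_def algebra_simps)
      next
        case 3
        have "h x + d x * (p - x) \<le> f p" using tan[of x p] True assms(3) hp by auto
        moreover have "f p + d p * (y - p) \<le> h y" using tp[OF y] h[OF y] 3 by auto
        moreover have "d p * (p - y) \<le> d x * (p - y)"
          using dmono[of p x] True 3 assms(3) by (cases "x = p") (auto intro!: mult_right_mono)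
        ultimately show ?thesis using True by (simp add: e_def algebra_simps)
      qed
    next
      case False
      then have hx: "h x = f x" using h x by auto
      show ?thesis
      proof (cases "y \<in> {p..q}")
        case False
        then show ?thesis using s[OF x y] hx h[OF y] \<open>x \<notin> {p..q}\<close> by (auto simp: e_def)
      next
        case True
        consider "x > q" | "x < p" using False by force
        then show ?thesis
        proof cases
          case 1
          have a: "f x + s x * (q - x) \<le> f q" using s[OF x, of q] assms by simp
          have "(s x - d q) * (x - q) \<ge> 0" using tq[OF x] a by (simp add: algebra_simps)
          then have "d q \<le> s x" using 1 by (simp add: zero_le_mult_iff)
          then have "d q * (q - y) \<le> s x * (q - y)" using True by (auto intro!: mult_right_mono)
          then show ?thesis using a tan[of q y] True assms(3) hq hx False
            by (auto simp: e_def algebra_simps)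
        next
          case 2
          have a: "f x + s x * (p - x) \<le> f p" using s[OF x, of p] assms by simp
          have "(d p - s x) * (p - x) \<ge> 0" using tp[OF x] a by (simp add: algebra_simps)
          then have "s x \<le> d p" using 2 by (simp add: zero_le_mult_iff)
          then have "s x * (y - p) \<le> d p * (y - p)" using True by (auto intro!: mult_right_mono)
          then show ?thesis using a tan[of p y] True assms(3) hp hx False
            by (auto simp: e_def algebra_simps)
        qed
      qed
    qed
    then show "e x * (y - x) \<le> h y - h x" by simp
  qed simp
qed

text \<open>
  If a convex function increased anywhere, it would keep increasing with at least the same slope and
  could not agree with a nonincreasing function far out.  Nonnegativity is inherited from the values
  far out as well.
\<close>
lemma antimono_on_if_eventually_antimono:
  fixes h f :: "real \<Rightarrow> real"
  assumes h: "convex_on {0<..} h" and f: "antimono_on {0<..} f" "\<And>x. x > 0 \<Longrightarrow> 0 \<le> f x"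
    and eq: "\<And>x. x > q \<Longrightarrow> h x = f x"
  shows "antimono_on {0<..} h" "\<And>x. x > 0 \<Longrightarrow> 0 \<le> h x"
proof -
  have le: "h y \<le> h x" if "0 < x" "x < y" for x y
  proof (rule ccontr)
    assume c: "\<not> h y \<le> h x"
    define z where "z = max q y + 1"
    have z: "z > q" "z > y" "z > 0" using that by (auto simp: z_def)
    have "(h x - h y) / (x - y) \<le> (h z - h (z + 1)) / (z - (z + 1))"
      using convex_on_slope_le(1)[OF h, of x "z + 1" y] convex_on_slope_le(2)[OF h, of x "z + 1" z]
        that z by auto
    moreover have "(h x - h y) / (x - y) = (h y - h x) / (y - x)"
      by (metis minus_diff_eq minus_divide_divide)
    moreover have "(h y - h x) / (y - x) > 0" using c that by simp
    moreover have "h (z + 1) \<le> h z"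
      using f(1) eq[of z] eq[of "z+1"] z by (auto simp: monotone_on_def)
    ultimately show False by auto
  qed
  then show anti: "antimono_on {0<..} h"
    unfolding monotone_on_def using le by (metis greaterThan_iff order_le_less)
  show "0 \<le> h x" if "x > 0" for x
  proof -
    define z where "z = max q x + 1"
    have "z > q" "z > x" "z > 0" using that by (auto simp: z_def)
    then show ?thesis using le[OF that, of z] eq[of z] f(2)[of z] by auto
  qed
qed

text \<open>
  Only convexity of the highest derivative has to be checked for a function that agrees with a
  \<open>k\<close>-monotone one from some point on.  A convex derivative is nonincreasing and nonnegative by
  \<open>antimono_on_if_eventually_antimono\<close>, and this makes the signed derivative of the next lower order
  convex.
\<close>
lemma k_monotone_if_top_derivative_convex:
  fixes D :: "nat \<Rightarrow> real \<Rightarrow> real"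
  assumes g0: "k_monotone k g0"
    and g: "\<And>x. 0 < x \<Longrightarrow> g x = D 0 x"
    and D: "\<And>l x. l < k - 2 \<Longrightarrow> 0 < x \<Longrightarrow> (D l has_real_derivative D (Suc l) x) (at x)"
    and top: "convex_on {0<..} (\<lambda>x. (-1) ^ (k - 2) * D (k - 2) x)"
    and eq: "\<And>l x. l \<le> k - 2 \<Longrightarrow> q < x \<Longrightarrow> D l x = (deriv ^^ l) g0 x"
  shows "k_monotone k g"
proof -
  define h where "h l x = (-1) ^ l * D l x" for l x
  have step: "antimono_on {0<..} (h l) \<and> (\<forall>x>0. 0 \<le> h l x)" 
    if "convex_on {0<..} (h l)" "l \<le> k - 2" for l
  proof -
    have "antimono_on {0<..} (\<lambda>x. (-1) ^ l * (deriv ^^ l) g0 x)"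
      "\<And>x. x > 0 \<Longrightarrow> 0 \<le> (-1) ^ l * (deriv ^^ l) g0 x"
      using g0 that(2) unfolding k_monotone_def by blast+
    from antimono_on_if_eventually_antimono[OF that(1) this, of q] show ?thesis
      using eq that(2) by (auto simp: h_def)
  qed
  have conv: "convex_on {0<..} (h l)" if "l \<le> k - 2" for l
    using that
  proof (induction rule: inc_induct)
    case base
    then show ?case using top by (simp add: h_def[abs_def])
  next
    case (step l)
    show ?case
    proof (rule convex_on_realI)
      fix x :: real assume "x \<in> {0<..}"
      then show "(h l has_real_derivative - h (Suc l) x) (at x)"
        using D[of l x] step.hyps unfolding h_def by (auto intro!: derivative_eq_intros)
    next
      fix x y :: real assume "x \<in> {0<..}" "y \<in> {0<..}" "x \<le> y"
      then show "- h (Suc l) x \<le> - h (Suc l) y"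
        using step(3) \<open>\<And>l. _ \<Longrightarrow> _ \<Longrightarrow> antimono_on {0<..} (h l) \<and> _\<close>[of "Suc l"] step.hyps
        by (auto simp: monotone_on_def)
    qed simp
  qed
  have d: "(deriv ^^ l) g x = D l x" if "l \<le> k - 2" "x > 0" for l x
    by (rule higher_deriv_eqI[of "{0<..}" g D "k - 2"]) (use that g D in auto)
  have dd: "(deriv ^^ l) g differentiable (at x)" if "l < k - 2" "x > 0" for l x
    using higher_deriv_differentiableI[of "{0<..}" g D "k - 2" l x] that g D
    by (auto simp: real_differentiable_def)
  have "antimono_on {0<..} (h l)" "\<forall>x>0. 0 \<le> h l x" "convex_on {0<..} (h l)" if "l \<le> k - 2" for l
    using step conv that by blast+
  moreover have "convex_on {0<..} (\<lambda>x. (-1) ^ l * (deriv ^^ l) g x)" if "l \<le> k - 2" for l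
  proof (rule convex_onI)
    fix t x y :: real assume t: "0 < t" "t < 1" and xy: "x \<in> {0<..}" "y \<in> {0<..}"
    then have "(1 - t) * x + t * y > 0" by (auto intro!: add_pos_pos)
    then show "(-1) ^ l * (deriv ^^ l) g ((1 - t) *\<^sub>R x + t *\<^sub>R y)
        \<le> (1 - t) * ((-1) ^ l * (deriv ^^ l) g x) + t * ((-1) ^ l * (deriv ^^ l) g y)"
      using convex_onD[OF conv[OF that], of t x y] t xy d[OF that] by (auto simp: h_def)
  qed simp
  ultimately show ?thesis
    unfolding k_monotone_def using d dd by (auto simp: monotone_on_def h_def)
qed

lemma convex_on_tangent:
  fixes f :: "real \<Rightarrow> real"
  assumes "convex_on {0<..} f" "(f has_real_derivative d) (at c)" "0 < c" "0 < x"
  shows "f c + d * (x - c) \<le> f x"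
  using convex_on_imp_above_tangent[OF assms(1), of c x d] assms
  by (auto simp: interior_open has_field_derivative_at_within)

text \<open>
  The contact of order \<open>k - 1\<close> at the end points makes the glued function \<open>k - 2\<close> times
  differentiable, and makes the slopes of its derivative of order \<open>k - 2\<close> match there, as
  \<open>convex_on_replace\<close> requires.
\<close>
lemma k_monotone_replace:
  fixes F :: "nat \<Rightarrow> real \<Rightarrow> real"
  assumes k: "2 \<le> k" and g0: "k_monotone k g0" and pq: "0 < p" "p < q"
    and F: "\<And>l x. l < k \<Longrightarrow> (F l has_real_derivative F (Suc l) x) (at x)"
    and ends: "\<And>l. l \<le> k - 2 \<Longrightarrow> F l p = (deriv ^^ l) g0 p"
      "\<And>l. l \<le> k - 2 \<Longrightarrow> F l q = (deriv ^^ l) g0 q"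
      "((deriv ^^ (k - 2)) g0 has_real_derivative F (k - 1) p) (at p)"
      "((deriv ^^ (k - 2)) g0 has_real_derivative F (k - 1) q) (at q)"
    and sgn: "\<And>x. x \<in> {p..q} \<Longrightarrow> 0 \<le> (-1) ^ k * F k x"
  shows "k_monotone k (\<lambda>x. if x \<in> {p..q} then F 0 x else g0 x)"
proof (rule k_monotone_if_top_derivative_convex[OF g0, where q = q])
  define D where "D l = (\<lambda>x. if x \<in> {p..q} then F l x else (deriv ^^ l) g0 x)" for l
  define f where "f x = (-1) ^ (k - 2) * (deriv ^^ (k - 2)) g0 x" for x
  have sg: "(-1) ^ (k - 2) = ((-1) ^ k :: real)"
    using k by (metis le_add_diff_inverse2 power_add power2_minus power_one mult.right_neutral)
  have conv: "convex_on {0<..} f" using g0 by (auto simp: k_monotone_def f_def[abs_def])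
  show "(D l has_real_derivative D (Suc l) x) (at x)" if "l < k - 2" "0 < x" for l x
  proof -
    have "(deriv ^^ l) g0 differentiable (at x)" using g0 that by (auto simp: k_monotone_def)
    then have "((deriv ^^ l) g0 has_real_derivative (deriv ^^ Suc l) g0 x) (at x)"
      by (simp add: DERIV_deriv_iff_real_differentiable)
    moreover have "(deriv ^^ Suc l) g0 p = F (Suc l) p" "(deriv ^^ Suc l) g0 q = F (Suc l) q"
      using ends(1)[of "Suc l"] ends(2)[of "Suc l"] that by (auto simp del: funpow.simps)
    ultimately show ?thesis
      unfolding D_def using F[of l x] that pq ends(1,2)[of l]
      by (intro DERIV_glue_interval) (auto simp del: funpow.simps)
  qed
  show "convex_on {0<..} (\<lambda>x. (-1) ^ (k - 2) * D (k - 2) x)"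
  proof (rule convex_on_replace[OF conv, where p = p and q = q and d = "\<lambda>x. (-1) ^ k * F (k - 1) x"])
    have "Suc (k - 2) = k - 1" "Suc (k - 1) = k" using k by auto
    note F' = F[of "k - 2", unfolded this(1)] F[of "k - 1", unfolded this(2)]
    have fp: "(f has_real_derivative (-1) ^ k * F (k - 1) p) (at p)"
      unfolding f_def[abs_def] sg by (rule DERIV_cmult[OF ends(3)])
    have fq: "(f has_real_derivative (-1) ^ k * F (k - 1) q) (at q)"
      unfolding f_def[abs_def] sg by (rule DERIV_cmult[OF ends(4)])
    show "f p + (-1) ^ k * F (k - 1) p * (y - p) \<le> f y" if "y > 0" for y
      using convex_on_tangent[OF conv fp] that pq by simp
    show "f q + (-1) ^ k * F (k - 1) q * (y - q) \<le> f y" if "y > 0" for y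
      using convex_on_tangent[OF conv fq] that pq by simp
    show "(-1) ^ (k - 2) * D (k - 2) y = f y" if "y > 0" "y \<notin> {p<..<q}" for y
      using that ends(1,2)[of "k - 2"] pq by (cases "y = p \<or> y = q") (auto simp: D_def f_def)
    show "(-1) ^ (k - 2) * D (k - 2) x + (-1) ^ k * F (k - 1) x * (y - x) \<le> (-1) ^ (k - 2) * D (k - 2) y"
      if "x \<in> {p..q}" "y \<in> {p..q}" for x y
    proof -
      have "(-1) ^ k * F (k - 1) x * (y - x) \<le> (-1) ^ k * F (k - 2) y - (-1) ^ k * F (k - 2) x"
        by (rule f''_imp_f'[of "{p..q}" "\<lambda>x. (-1) ^ k * F (k - 2) x" "\<lambda>x. (-1) ^ k * F (k - 1) x"
              "\<lambda>x. (-1) ^ k * F k x"])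
          (use that F' sgn k in \<open>auto intro!: DERIV_cmult\<close>)
      then show ?thesis using that by (simp add: D_def sg)
    qed
  qed (use pq in auto)
  show "\<And>x. (if x \<in> {p..q} then F 0 x else g0 x) = D 0 x" by (simp add: D_def)
  show "\<And>l x. q < x \<Longrightarrow> D l x = (deriv ^^ l) g0 x" by (simp add: D_def)
qed

lemma k_monotone_continuous_on:
  assumes "k_monotone k g"
  shows "continuous_on {0<..} g"
proof -
  have "convex_on {0<..} (\<lambda>x. (-1) ^ 0 * (deriv ^^ 0) g x)"
    using assms unfolding k_monotone_def by blast
  then show ?thesis by (intro convex_on_continuous) auto
qed

lemma k_monotone_nonneg:
  assumes "k_monotone k g" "x > 0"
  shows "0 \<le> g x"
proof -
  have "0 \<le> (-1) ^ 0 * (deriv ^^ 0) g x"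
    using assms unfolding k_monotone_def by blast
  then show ?thesis by simp
qed

lemma k_monotone_measurable:
  assumes "k_monotone k g"
  shows "(\<lambda>x. ennreal (g x) * indicator {0<..} x) \<in> borel_measurable lborel"
proof -
  have "(\<lambda>x. indicator {0<..} x *\<^sub>R g x) \<in> borel_measurable borel"
    by (intro borel_measurable_continuous_on_indicator k_monotone_continuous_on[OF assms]) auto
  then have "(\<lambda>x. ennreal (indicator {0<..} x *\<^sub>R g x)) \<in> borel_measurable lborel" by simp
  also have "(\<lambda>x. ennreal (indicator {0<..} x *\<^sub>R g x)) = (\<lambda>x. ennreal (g x) * indicator {0<..} x)"
    by (auto simp: indicator_def)
  finally show ?thesis .
qed

lemma k_monotone_density_replace:
  fixes F :: "nat \<Rightarrow> real \<Rightarrow> real"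
  assumes k: "2 \<le> k" and g0: "g0 \<in> k_monotone_densities k" and pq: "0 < p" "p < q"
    and F: "\<And>l x. l < k \<Longrightarrow> (F l has_real_derivative F (Suc l) x) (at x)"
    and ends: "\<And>l. l \<le> k - 2 \<Longrightarrow> F l p = (deriv ^^ l) g0 p"
      "\<And>l. l \<le> k - 2 \<Longrightarrow> F l q = (deriv ^^ l) g0 q"
      "((deriv ^^ (k - 2)) g0 has_real_derivative F (k - 1) p) (at p)"
      "((deriv ^^ (k - 2)) g0 has_real_derivative F (k - 1) q) (at q)"
    and sgn: "\<And>x. x \<in> {p..q} \<Longrightarrow> 0 \<le> (-1) ^ k * F k x"
    and mass: "integral {p..q} (F 0) = integral {p..q} g0"
  shows "(\<lambda>x. if x \<in> {p..q} then F 0 x else g0 x) \<in> k_monotone_densities k"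
proof -
  define g where "g = (\<lambda>x. if x \<in> {p..q} then F 0 x else g0 x)"
  have g0m: "k_monotone k g0" using g0 by (simp add: k_monotone_densities_def)
  have gm: "k_monotone k g"
    unfolding g_def by (rule k_monotone_replace[OF k g0m pq F ends sgn])
  have part: "(\<integral>\<^sup>+x\<in>{p..q}. ennreal (u x) \<partial>lborel) = ennreal (integral {p..q} u)"
    if u: "k_monotone k u" for u
  proof -
    have c: "continuous_on {p..q} u"
      by (rule continuous_on_subset[OF k_monotone_continuous_on[OF u]]) (use pq in auto)
    have "(\<integral>\<^sup>+x. ennreal (indicator {p..q} x * u x) \<partial>lborel) = ennreal (LINT x|lborel. indicator {p..q} x * u x)"
    proof (rule nn_integral_eq_integral)
      show "integrable lborel (\<lambda>x. indicator {p..q} x * u x)"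
        using borel_integrable_atLeastAtMost'[OF c] by (simp add: set_integrable_def)
    qed (use k_monotone_nonneg[OF u] pq in \<open>auto simp: indicator_def\<close>)
    moreover have "(LINT x|lborel. indicator {p..q} x * u x) = integral {p..q} u"
      using set_borel_integral_eq_integral(2)[OF borel_integrable_atLeastAtMost'[OF c]]
      by (simp add: set_lebesgue_integral_def)
    moreover have "(\<integral>\<^sup>+x\<in>{p..q}. ennreal (u x) \<partial>lborel) = (\<integral>\<^sup>+x. ennreal (indicator {p..q} x * u x) \<partial>lborel)"
      by (intro nn_integral_cong) (auto simp: indicator_def)
    ultimately show ?thesis by simp
  qed
  have split: "(\<integral>\<^sup>+x\<in>{0<..}. ennreal (u x) \<partial>lborel)
      = ennreal (integral {p..q} u) + (\<integral>\<^sup>+x\<in>{0<..} - {p..q}. ennreal (u x) \<partial>lborel)"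
    if u: "k_monotone k u" for u
  proof -
    note [measurable] = k_monotone_measurable[OF u]
    have "(\<integral>\<^sup>+x\<in>{0<..}. ennreal (u x) \<partial>lborel) = 
      (\<integral>\<^sup>+x. (ennreal (u x) * indicator {0<..} x) * indicator {p..q} x 
        + (ennreal (u x) * indicator {0<..} x) * indicator (- {p..q}) x \<partial>lborel)"
      by (intro nn_integral_cong) (auto simp: indicator_def)
    also have "\<dots> = (\<integral>\<^sup>+x. (ennreal (u x) * indicator {0<..} x) * indicator {p..q} x \<partial>lborel)
      + (\<integral>\<^sup>+x. (ennreal (u x) * indicator {0<..} x) * indicator (- {p..q}) x \<partial>lborel)"
      by (rule nn_integral_add) measurable
    also have "(\<integral>\<^sup>+x. (ennreal (u x) * indicator {0<..} x) * indicator {p..q} x \<partial>lborel)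
      = (\<integral>\<^sup>+x\<in>{p..q}. ennreal (u x) \<partial>lborel)"
      using pq by (intro nn_integral_cong) (auto simp: indicator_def)
    also have "(\<integral>\<^sup>+x. (ennreal (u x) * indicator {0<..} x) * indicator (- {p..q}) x \<partial>lborel)
      = (\<integral>\<^sup>+x\<in>{0<..} - {p..q}. ennreal (u x) \<partial>lborel)"
      by (intro nn_integral_cong) (auto simp: indicator_def)
    finally show ?thesis using part[OF u] by simp
  qed
  have "(\<integral>\<^sup>+x\<in>{0<..}. ennreal (g x) \<partial>lborel) = (\<integral>\<^sup>+x\<in>{0<..}. ennreal (g0 x) \<partial>lborel)"
  proof -
    have "integral {p..q} g = integral {p..q} g0"
      unfolding mass[symmetric] by (intro integral_cong) (simp add: g_def)
    moreover have "(\<integral>\<^sup>+x\<in>{0<..} - {p..q}. ennreal (g x) \<partial>lborel) = (\<integral>\<^sup>+x\<in>{0<..} - {p..q}. ennreal (g0 x) \<partial>lborel)"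
      by (intro nn_integral_cong) (auto simp: g_def indicator_def)
    ultimately show ?thesis using split[OF gm] split[OF g0m] by simp
  qed
  then show ?thesis using gm g0 by (simp add: k_monotone_densities_def g_def)
qed

section \<open>The two-point lower bound for the minimax risk\<close>

lemma PiM_density:
  fixes L :: "'a \<Rightarrow> ennreal"
  assumes M: "prob_space M" and N: "prob_space (density M L)"
    and [measurable]: "L \<in> borel_measurable M" and fin: "finite I"
  shows "(\<Pi>\<^sub>M i\<in>I. density M L) = density (\<Pi>\<^sub>M i\<in>I. M) (\<lambda>x. \<Prod>i\<in>I. L (x i))"
proof -
  interpret M: prob_space M by fact
  interpret N: prob_space "density M L" by fact
  interpret PM: product_sigma_finite "\<lambda>i. M" by standard
  interpret PN: product_sigma_finite "\<lambda>i. density M L" by standard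
  have "density (\<Pi>\<^sub>M i\<in>I. M) (\<lambda>x. \<Prod>i\<in>I. L (x i)) = (\<Pi>\<^sub>M i\<in>I. density M L)"
  proof (rule PN.PiM_eqI[OF fin])
    show "sets (density (\<Pi>\<^sub>M i\<in>I. M) (\<lambda>x. \<Prod>i\<in>I. L (x i))) = sets (\<Pi>\<^sub>M i\<in>I. density M L)"
      by (simp cong: sets_PiM_cong)
    fix A assume A: "\<And>i. i \<in> I \<Longrightarrow> A i \<in> sets (density M L)"
    then have A': "\<And>i. i \<in> I \<Longrightarrow> A i \<in> sets M" by simp
    have PA: "(\<Pi>\<^sub>E i\<in>I. A i) \<in> sets (\<Pi>\<^sub>M i\<in>I. M)"
      using A' by (intro sets_PiM_I_finite fin) auto
    have "emeasure (density (\<Pi>\<^sub>M i\<in>I. M) (\<lambda>x. \<Prod>i\<in>I. L (x i))) (\<Pi>\<^sub>E i\<in>I. A i)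
      = (\<integral>\<^sup>+x. (\<Prod>i\<in>I. L (x i)) * indicator (\<Pi>\<^sub>E i\<in>I. A i) x \<partial>(\<Pi>\<^sub>M i\<in>I. M))"
      by (rule emeasure_density[OF _ PA]) measurable
    also have "\<dots> = (\<integral>\<^sup>+x. (\<Prod>i\<in>I. L (x i) * indicator (A i) (x i)) \<partial>(\<Pi>\<^sub>M i\<in>I. M))"
    proof (intro nn_integral_cong)
      fix x assume x: "x \<in> space (\<Pi>\<^sub>M i\<in>I. M)"
      have "indicator (\<Pi>\<^sub>E i\<in>I. A i) x = (\<Prod>i\<in>I. indicator (A i) (x i) :: ennreal)"
      proof (cases "\<forall>i\<in>I. x i \<in> A i")
        case True
        then show ?thesis using x by (auto simp: space_PiM PiE_iff intro!: prod.neutral[symmetric])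
      next
        case False
        then obtain i where "i \<in> I" "x i \<notin> A i" by blast
        then have "(\<Prod>i\<in>I. indicator (A i) (x i) :: ennreal) = 0"
          using fin by (auto simp: indicator_def)
        moreover have "x \<notin> (\<Pi>\<^sub>E i\<in>I. A i)"
          using \<open>i \<in> I\<close> \<open>x i \<notin> A i\<close> by (auto simp: PiE_iff)
        ultimately show ?thesis by simp
      qed
      then show "(\<Prod>i\<in>I. L (x i)) * indicator (\<Pi>\<^sub>E i\<in>I. A i) x = (\<Prod>i\<in>I. L (x i) * indicator (A i) (x i))"
        by (simp add: prod.distrib)
    qed
    also have "\<dots> = (\<Prod>i\<in>I. \<integral>\<^sup>+x. L x * indicator (A i) x \<partial>M)"
      by (rule PM.product_nn_integral_prod[OF fin]) (use A' in auto)
    also have "\<dots> = (\<Prod>i\<in>I. emeasure (density M L) (A i))"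
      using A' by (intro prod.cong refl) (simp add: emeasure_density)
    finally show "emeasure (density (\<Pi>\<^sub>M i\<in>I. M) (\<lambda>x. \<Prod>i\<in>I. L (x i))) (\<Pi>\<^sub>E i\<in>I. A i)
      = (\<Prod>i\<in>I. emeasure (density M L) (A i))" .
  qed
  then show ?thesis by simp
qed

lemma ennreal_half_leI:
  assumes "1 \<le> m + ennreal (1/4) * ennreal 2"
  shows "ennreal (1/2) \<le> m"
proof (cases m)
  case (real r)
  have "ennreal (1/4) * ennreal 2 = ennreal (1/2)"
    by (simp add: ennreal_mult[symmetric] del: ennreal_half ennreal_numeral)
  then have "ennreal 1 \<le> ennreal (r + 1/2)"
    using assms real by (simp add: ennreal_plus[symmetric] del: ennreal_half ennreal_plus)
  then have "1 \<le> r + 1/2" using real by (simp only: ennreal_le_iff)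
  then have "1/2 \<le> r" by simp
  then show ?thesis unfolding real(2) by (rule ennreal_leI)
qed simp

lemma ennreal_quarter_leI:
  assumes "ennreal (a / 2) \<le> R + R" "0 \<le> a"
  shows "ennreal (a / 4) \<le> R"
  using assms by (cases R) (auto simp flip: ennreal_plus)

text \<open>
  The integral bounded here is one minus the total variation distance of the two product measures.
  The bound rests on the inequality \<open>min 1 l \<ge> l - l\<^sup>2 / 4\<close>: the likelihood ratio has mean \<open>1\<close>, and
  its second moment is the \<open>n\<close>-th power of that of a single observation.
\<close>
lemma testing_affinity_ge:
  fixes L :: "'a \<Rightarrow> real"
  assumes M: "prob_space M" and N: "prob_space (density M (\<lambda>x. ennreal (L x)))"
    and [measurable]: "L \<in> borel_measurable M" and pos: "\<And>x. 0 \<le> L x"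
    and sq: "(\<integral>\<^sup>+x. ennreal ((L x)\<^sup>2) \<partial>M) \<le> ennreal v" and v: "0 \<le> v" "v ^ n \<le> 2"
  shows "ennreal (1/2) \<le> (\<integral>\<^sup>+X. ennreal (min 1 (\<Prod>i<n. L (X i))) \<partial>(\<Pi>\<^sub>M i\<in>{..<n}. M))"
proof -
  interpret M: prob_space M by fact
  interpret N: prob_space "density M (\<lambda>x. ennreal (L x))" by fact
  interpret PM: product_sigma_finite "\<lambda>i. M" by standard
  let ?P = "\<Pi>\<^sub>M i\<in>{..<n}. M" and ?L = "\<lambda>X. \<Prod>i<n. L (X i)"
  have L0: "0 \<le> ?L X" for X using pos by (intro prod_nonneg) auto
  have one: "(\<integral>\<^sup>+x. ennreal (L x) \<partial>M) = 1"
    using N.emeasure_space_1 by (simp add: emeasure_density nn_integral_set_ennreal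
      cong: nn_integral_cong)
  have "(\<integral>\<^sup>+X. ennreal (?L X) \<partial>?P) = (\<integral>\<^sup>+X. (\<Prod>i<n. ennreal (L (X i))) \<partial>?P)"
    using pos by (simp add: prod_ennreal)
  also have "\<dots> = (\<Prod>i<n. \<integral>\<^sup>+x. ennreal (L x) \<partial>M)"
    by (intro PM.product_nn_integral_prod) auto
  also have "\<dots> = 1" using one by simp
  finally have 1: "(\<integral>\<^sup>+X. ennreal (?L X) \<partial>?P) = 1" .
  have "(\<integral>\<^sup>+X. ennreal ((?L X)\<^sup>2) \<partial>?P) = (\<integral>\<^sup>+X. (\<Prod>i<n. ennreal ((L (X i))\<^sup>2)) \<partial>?P)"
    by (simp add: prod_ennreal prod_power_distrib)
  also have "\<dots> = (\<Prod>i<n. \<integral>\<^sup>+x. ennreal ((L x)\<^sup>2) \<partial>M)"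
    by (intro PM.product_nn_integral_prod) auto
  also have "\<dots> \<le> ennreal (v ^ n)"
    using sq v(1) by (cases "\<integral>\<^sup>+x. ennreal ((L x)\<^sup>2) \<partial>M")
      (auto simp: ennreal_power top_unique intro!: ennreal_leI power_mono)
  also have "\<dots> \<le> ennreal 2" using v by (intro ennreal_leI) simp
  finally have 2: "(\<integral>\<^sup>+X. ennreal ((?L X)\<^sup>2) \<partial>?P) \<le> ennreal 2" .
  have "ennreal (?L X) \<le> ennreal (min 1 (?L X)) + ennreal (1/4) * ennreal ((?L X)\<^sup>2)" for X
  proof -
    have "?L X - (?L X)\<^sup>2 / 4 \<le> 1"
      using zero_le_power2[of "?L X / 2 - 1"] by (simp add: power2_eq_square field_simps)
    then have "?L X \<le> min 1 (?L X) + 1/4 * (?L X)\<^sup>2" by (simp add: min_def)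
    then have "ennreal (?L X) \<le> ennreal (min 1 (?L X) + 1/4 * (?L X)\<^sup>2)" by (rule ennreal_leI)
    also have "\<dots> = ennreal (min 1 (?L X)) + ennreal (1/4) * ennreal ((?L X)\<^sup>2)"
      using L0[of X] by (subst ennreal_plus) (auto simp: ennreal_mult[symmetric])
    finally show ?thesis .
  qed
  then have "(\<integral>\<^sup>+X. ennreal (?L X) \<partial>?P) \<le> (\<integral>\<^sup>+X. ennreal (min 1 (?L X)) + ennreal (1/4) * ennreal ((?L X)\<^sup>2) \<partial>?P)"
    by (intro nn_integral_mono)
  also have "\<dots> = (\<integral>\<^sup>+X. ennreal (min 1 (?L X)) \<partial>?P) + ennreal (1/4) * (\<integral>\<^sup>+X. ennreal ((?L X)\<^sup>2) \<partial>?P)"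
    by (subst nn_integral_add) (auto simp: nn_integral_cmult)
  also have "\<dots> \<le> (\<integral>\<^sup>+X. ennreal (min 1 (?L X)) \<partial>?P) + ennreal (1/4) * ennreal 2"
    using 2 by (intro add_mono mult_left_mono) auto
  finally have "1 \<le> (\<integral>\<^sup>+X. ennreal (min 1 (?L X)) \<partial>?P) + ennreal (1/4) * ennreal 2"
    using 1 by simp
  then show ?thesis by (rule ennreal_half_leI)
qed

text \<open>
  Le Cam's method: at every sample point the errors for \<open>T f\<close> and \<open>T g\<close> add up to at least
  \<open>\<bar>T f - T g\<bar>\<close>, and the overlap of the two laws has mass at least one half, so one of the two risks is
  at least a quarter of this distance.
\<close>
lemma minimax_risk_L1_two_points:
  assumes fD: "f \<in> D" and gD: "g \<in> D"
    and P: "prob_space (density_law f)" and Q: "prob_space (density_law g)"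
    and [measurable]: "L \<in> borel_measurable borel" and pos: "\<And>x. 0 \<le> L x"
    and fg: "density_law g = density (density_law f) (\<lambda>x. ennreal (L x))"
    and sq: "(\<integral>\<^sup>+x. ennreal ((L x)\<^sup>2) \<partial>density_law f) \<le> ennreal v" and v: "0 \<le> v" "v ^ n \<le> 2"
  shows "ennreal (\<bar>T f - T g\<bar> / 4) \<le> minimax_risk_L1 n T D"
  unfolding minimax_risk_L1_def
proof (rule INF_greatest)
  fix t :: "(nat \<Rightarrow> real) \<Rightarrow> real" assume "t \<in> borel_measurable (\<Pi>\<^sub>M i\<in>{..<n}. (borel :: real measure))"
  moreover have "sets (\<Pi>\<^sub>M i\<in>{..<n}. density_law f) = sets (\<Pi>\<^sub>M i\<in>{..<n}. (borel :: real measure))"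
    by (intro sets_PiM_cong) (auto simp: density_law_def)
  ultimately have [measurable]: "t \<in> borel_measurable (\<Pi>\<^sub>M i\<in>{..<n}. density_law f)"
    by (metis measurable_cong_sets)
  have [measurable]: "L \<in> borel_measurable (density_law f)" by (simp add: density_law_def)
  let ?P = "\<Pi>\<^sub>M i\<in>{..<n}. density_law f" and ?L = "\<lambda>X. \<Prod>i<n. L (X i)"
  have L0: "0 \<le> ?L X" for X using pos by (intro prod_nonneg) auto
  let ?R = "SUP h\<in>D. \<integral>\<^sup>+X. ennreal \<bar>t X - T h\<bar> \<partial>sample_law n h"
  have Qn: "sample_law n g = density ?P (\<lambda>X. ennreal (?L X))"
    unfolding sample_law_def fg
    by (subst PiM_density) (use P Q fg pos in \<open>auto simp: prod_ennreal\<close>)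
  have "ennreal \<bar>T f - T g\<bar> * ennreal (min 1 (?L X))
    \<le> ennreal \<bar>t X - T f\<bar> + ennreal (?L X) * ennreal \<bar>t X - T g\<bar>" for X
  proof -
    have "\<bar>T f - T g\<bar> * min 1 (?L X) \<le> (\<bar>t X - T f\<bar> + \<bar>t X - T g\<bar>) * min 1 (?L X)"
      using L0[of X] by (intro mult_right_mono) auto
    also have "\<dots> \<le> \<bar>t X - T f\<bar> * 1 + \<bar>t X - T g\<bar> * ?L X"
      unfolding distrib_right by (intro add_mono mult_left_mono) auto
    finally have "ennreal (\<bar>T f - T g\<bar> * min 1 (?L X)) \<le> ennreal (\<bar>t X - T f\<bar> * 1 + \<bar>t X - T g\<bar> * ?L X)"
      by (rule ennreal_leI)
    then show ?thesis using L0[of X] by (simp add: ennreal_plus ennreal_mult mult.commute)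
  qed
  then have "(\<integral>\<^sup>+X. ennreal \<bar>T f - T g\<bar> * ennreal (min 1 (?L X)) \<partial>?P)
     \<le> (\<integral>\<^sup>+X. ennreal \<bar>t X - T f\<bar> + ennreal (?L X) * ennreal \<bar>t X - T g\<bar> \<partial>?P)"
    by (intro nn_integral_mono)
  also have "\<dots> = (\<integral>\<^sup>+X. ennreal \<bar>t X - T f\<bar> \<partial>sample_law n f) + (\<integral>\<^sup>+X. ennreal \<bar>t X - T g\<bar> \<partial>sample_law n g)"
    unfolding Qn by (subst nn_integral_add) (auto simp: nn_integral_density sample_law_def)
  also have "\<dots> \<le> ?R + ?R"
    using fD gD by (intro add_mono SUP_upper2[of f] SUP_upper2[of g]) auto
  finally have 1: "ennreal \<bar>T f - T g\<bar> * (\<integral>\<^sup>+X. ennreal (min 1 (?L X)) \<partial>?P) \<le> ?R + ?R"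
    by (simp add: nn_integral_cmult)
  have "ennreal (\<bar>T f - T g\<bar> / 2) = ennreal \<bar>T f - T g\<bar> * ennreal (1/2)"
    by (simp add: ennreal_mult[symmetric] del: ennreal_half)
  also have "\<dots> \<le> ennreal \<bar>T f - T g\<bar> * (\<integral>\<^sup>+X. ennreal (min 1 (?L X)) \<partial>?P)"
    using testing_affinity_ge[OF P _ _ pos sq v] Q fg by (intro mult_left_mono) auto
  also note 1
  finally have "ennreal (\<bar>T f - T g\<bar> / 2) \<le> ?R + ?R" .
  then show "ennreal (\<bar>T f - T g\<bar> / 4) \<le> ?R" by (rule ennreal_quarter_leI) simp
qed

text \<open>
  Where \<open>h\<close> is bounded below by \<open>c\<close>, the difference of the square roots is at most
  \<open>\<bar>f x - h x\<bar> / sqrt c\<close>.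
\<close>
lemma hellinger_sq_le_local:
  fixes f h :: "real \<Rightarrow> real"
  assumes "p \<le> q" "0 < c" and nonneg: "\<And>x. 0 < x \<Longrightarrow> 0 \<le> f x"
    and off: "\<And>x. x \<notin> {p..q} \<Longrightarrow> f x = h x"
    and D: "\<And>x. x \<in> {p..q} \<Longrightarrow> \<bar>f x - h x\<bar> \<le> D"
    and c: "\<And>x. x \<in> {p..q} \<Longrightarrow> c \<le> h x"
  shows "hellinger_sq f h \<le> (q - p) * D\<^sup>2 / (2 * c)"
proof -
  have pt: "(sqrt (f x) - sqrt (h x))\<^sup>2 \<le> D\<^sup>2 / c" if "x \<in> {p..q}" "0 < x" for x
  proof -
    have fh: "0 \<le> f x" "c \<le> h x" using nonneg c that by auto
    have "(sqrt (f x) - sqrt (h x))\<^sup>2 * c \<le> (sqrt (f x) - sqrt (h x))\<^sup>2 * (sqrt (f x) + sqrt (h x))\<^sup>2"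
    proof (intro mult_left_mono)
      have "c \<le> (sqrt (h x))\<^sup>2" using fh \<open>0 < c\<close> by simp
      also have "\<dots> \<le> (sqrt (f x) + sqrt (h x))\<^sup>2"
        using fh \<open>0 < c\<close> by (intro power_mono) auto
      finally show "c \<le> (sqrt (f x) + sqrt (h x))\<^sup>2" .
    qed simp
    also have "\<dots> = ((sqrt (f x))\<^sup>2 - (sqrt (h x))\<^sup>2)\<^sup>2"
      by (simp only: power_mult_distrib[symmetric] power2_eq_square square_diff_square_factored)
        (simp only: mult_ac)
    also have "\<dots> = \<bar>f x - h x\<bar>\<^sup>2" using fh \<open>0 < c\<close> by simp
    also have "\<dots> \<le> D\<^sup>2" using D[OF that(1)] by (intro power_mono) auto
    finally show ?thesis using \<open>0 < c\<close> by (simp add: pos_le_divide_eq)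
  qed
  have "(LINT x:{0<..}|lborel. (sqrt (f x) - sqrt (h x))\<^sup>2) \<le> (LINT x|lborel. indicator {p..q} x * (D\<^sup>2 / c))"
    unfolding set_lebesgue_integral_def
  proof (rule integral_mono')
    show "integrable lborel (\<lambda>x. indicator {p..q} x * (D\<^sup>2 / c))"
      by (intro integrable_mult_left integrable_real_indicator) (auto simp: emeasure_lborel_Icc_eq)
    show "indicator {0<..} x *\<^sub>R (sqrt (f x) - sqrt (h x))\<^sup>2 \<le> indicator {p..q} x * (D\<^sup>2 / c)" for x
      using pt[of x] off[of x] \<open>0 < c\<close> by (cases "x \<in> {p..q}") (auto simp: indicator_def)
    show "0 \<le> indicator {p..q} x * (D\<^sup>2 / c)" for x using \<open>0 < c\<close> by simp
  qed
  also have "\<dots> = (q - p) * (D\<^sup>2 / c)" using \<open>p \<le> q\<close> by simp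
  finally have "hellinger_sq f h \<le> 1 / 2 * ((q - p) * (D\<^sup>2 / c))"
    unfolding hellinger_sq_def by (intro mult_left_mono) auto
  then show ?thesis by simp
qed

lemma prob_space_density_law:
  assumes "g \<in> k_monotone_densities k"
  shows "prob_space (density_law g)"
proof
  have "(\<lambda>x. ennreal (g x) * indicator {0<..} x) \<in> borel_measurable lborel"
    using assms by (intro k_monotone_measurable[of k]) (simp add: k_monotone_densities_def)
  then show "emeasure (density_law g) (space (density_law g)) = 1"
    using assms by (simp add: density_law_def emeasure_density k_monotone_densities_def)
qed

text \<open>
  The likelihood ratio is \<open>g x / f x\<close> on the interval and \<open>1\<close> elsewhere.  Its second moment is one
  plus the chi-square distance, the integral of \<open>(g x - f x)\<^sup>2 / f x\<close>, since \<open>f\<close> and \<open>g\<close> have equal mass.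
\<close>
lemma local_likelihood_ratio:
  fixes f g :: "real \<Rightarrow> real"
  assumes f: "f \<in> k_monotone_densities k" and g: "g \<in> k_monotone_densities k"
    and pq: "0 < p" "p \<le> q" and "0 < c"
    and off: "\<And>x. x \<notin> {p..q} \<Longrightarrow> g x = f x"
    and D: "\<And>x. x \<in> {p..q} \<Longrightarrow> \<bar>g x - f x\<bar> \<le> D"
    and c: "\<And>x. x \<in> {p..q} \<Longrightarrow> c \<le> f x"
  obtains L where "L \<in> borel_measurable borel" "\<And>x. 0 \<le> L x"
    "density_law g = density (density_law f) (\<lambda>x. ennreal (L x))"
    "(\<integral>\<^sup>+x. ennreal ((L x)\<^sup>2) \<partial>density_law f) \<le> ennreal (1 + (q - p) * D\<^sup>2 / c)"
proof -
  have fm: "k_monotone k f" and gm: "k_monotone k g" using f g by (auto simp: k_monotone_densities_def)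
  note [measurable] = k_monotone_measurable[OF fm] k_monotone_measurable[OF gm]
  have f0: "0 \<le> f x" and g0: "0 \<le> g x" if "0 < x" for x using k_monotone_nonneg fm gm that by auto
  have m: "(\<lambda>x. indicator {0<..} x *\<^sub>R u x) \<in> borel_measurable borel" if "k_monotone k u" for u
    by (intro borel_measurable_continuous_on_indicator k_monotone_continuous_on[OF that]) auto
  define f' where "f' x = indicator {0<..} x *\<^sub>R f x" for x
  define g' where "g' x = indicator {0<..} x *\<^sub>R g x" for x
  have [measurable]: "f' \<in> borel_measurable borel" "g' \<in> borel_measurable borel"
    unfolding f'_def[abs_def] g'_def[abs_def] using m fm gm by auto
  define L where "L x = (if x \<in> {p..q} then g' x / f' x else 1)" for x
  have L: "L x = (if x \<in> {p..q} then g x / f x else 1)" for x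
    using pq by (simp add: L_def f'_def g'_def)
  have Lm[measurable]: "L \<in> borel_measurable borel" unfolding L_def[abs_def] by measurable
  have L0: "0 \<le> L x" for x using f0 g0 pq by (auto simp: L intro!: divide_nonneg_nonneg)
  have fpos: "0 < f x" if "x \<in> {p..q}" for x using c[OF that] \<open>0 < c\<close> by linarith
  show ?thesis
  proof (rule that[of L])
    have "density (density_law f) (\<lambda>x. ennreal (L x))
      = density lborel (\<lambda>x. (ennreal (f x) * indicator {0<..} x) * ennreal (L x))"
      unfolding density_law_def by (intro density_density_eq) measurable
    also have "(\<lambda>x. (ennreal (f x) * indicator {0<..} x) * ennreal (L x)) = (\<lambda>x. ennreal (g x) * indicator {0<..} x)"
    proof
      fix x
      show "(ennreal (f x) * indicator {0<..} x) * ennreal (L x) = ennreal (g x) * indicator {0<..} x"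
      proof (cases "x \<in> {p..q}")
        case True
        then have "ennreal (f x) * ennreal (g x / f x) = ennreal (g x)"
          using fpos[OF True] g0[of x] pq by (subst ennreal_mult[symmetric]) auto
        then show ?thesis using True pq by (auto simp: L indicator_def)
      next
        case False
        then show ?thesis using off[OF False] unfolding L if_not_P[OF False] by simp
      qed
    qed
    finally show "density_law g = density (density_law f) (\<lambda>x. ennreal (L x))"
      by (simp add: density_law_def)
    define A where "A = (\<integral>\<^sup>+x. (ennreal (f x) * indicator {0<..} x) * ennreal ((L x)\<^sup>2) \<partial>lborel)"
    have A: "(\<integral>\<^sup>+x. ennreal ((L x)\<^sup>2) \<partial>density_law f) = A"
      unfolding A_def density_law_def by (intro nn_integral_density) measurable
    have pt: "(ennreal (f x) * indicator {0<..} x) * ennreal ((L x)\<^sup>2) + ennreal (f x) * indicator {0<..} x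
      \<le> 2 * (ennreal (g x) * indicator {0<..} x) + ennreal (D\<^sup>2 / c) * indicator {p..q} x" for x
    proof (cases "x \<in> {p..q}")
      case True
      have x: "0 < x" using True pq by auto
      have "(g x - f x)\<^sup>2 / f x \<le> D\<^sup>2 / c"
        using D[OF True] c[OF True] \<open>0 < c\<close> abs_le_square_iff[of "g x - f x" D]
        by (intro frac_le) (auto simp: abs_le_square_iff[symmetric])
      moreover have "f x * (g x / f x)\<^sup>2 + f x = 2 * g x + (g x - f x)\<^sup>2 / f x"
        using fpos[OF True] by (simp add: power2_eq_square field_simps)
      ultimately have "f x * (L x)\<^sup>2 + f x \<le> 2 * g x + D\<^sup>2 / c" using True by (simp add: L)
      then have "ennreal (f x * (L x)\<^sup>2 + f x) \<le> ennreal (2 * g x + D\<^sup>2 / c)" by (rule ennreal_leI)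
      moreover have "ennreal (f x * (L x)\<^sup>2 + f x) = ennreal (f x) * ennreal ((L x)\<^sup>2) + ennreal (f x)"
        using f0[OF x] by (simp add: ennreal_plus ennreal_mult)
      moreover have "ennreal (2 * g x + D\<^sup>2 / c) = 2 * ennreal (g x) + ennreal (D\<^sup>2 / c)"
        using g0[OF x] \<open>0 < c\<close> by (simp add: ennreal_plus ennreal_mult)
      ultimately show ?thesis using True x by simp
    next
      case False
      then show ?thesis using off[OF False] by (simp add: L mult_2)
    qed
    have "A + 1 = (\<integral>\<^sup>+x. (ennreal (f x) * indicator {0<..} x) * ennreal ((L x)\<^sup>2) + ennreal (f x) * indicator {0<..} x \<partial>lborel)"
      using f unfolding A_def by (subst nn_integral_add) (auto simp: k_monotone_densities_def)
    also have "\<dots> \<le> (\<integral>\<^sup>+x. 2 * (ennreal (g x) * indicator {0<..} x) + ennreal (D\<^sup>2 / c) * indicator {p..q} x \<partial>lborel)"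
      by (intro nn_integral_mono pt)
    also have "\<dots> = 2 + ennreal (D\<^sup>2 / c) * ennreal (q - p)"
      using g pq by (subst nn_integral_add) (auto simp: nn_integral_cmult k_monotone_densities_def)
    also have "\<dots> = ennreal (1 + (q - p) * D\<^sup>2 / c) + 1"
    proof -
      have "ennreal (D\<^sup>2 / c) * ennreal (q - p) = ennreal ((q - p) * D\<^sup>2 / c)"
        using pq \<open>0 < c\<close> by (subst ennreal_mult[symmetric]) (auto simp: mult.commute)
      moreover have "ennreal (1 + (q - p) * D\<^sup>2 / c) = 1 + ennreal ((q - p) * D\<^sup>2 / c)"
        using pq \<open>0 < c\<close> by (subst ennreal_plus) auto
      ultimately show ?thesis by (simp add: add_ac flip: one_add_one)
    qed
    finally have "A \<le> ennreal (1 + (q - p) * D\<^sup>2 / c)"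
      by (simp add: ennreal_add_left_cancel_le add.commute[of _ 1])
    then show "(\<integral>\<^sup>+x. ennreal ((L x)\<^sup>2) \<partial>density_law f) \<le> ennreal (1 + (q - p) * D\<^sup>2 / c)" by (simp add: A)
  qed (use L0 in auto)
qed

section \<open>Hermite interpolation at the end points of the unit interval\<close>

lemma pderiv_power_dvd:
  fixes p :: "real poly"
  assumes "q ^ Suc m dvd p"
  shows "q ^ m dvd pderiv p"
proof -
  obtain r where r: "p = q ^ Suc m * r" using assms by (auto elim: dvdE)
  have "pderiv p = q ^ Suc m * pderiv r + r * (smult (of_nat (Suc m)) (q ^ m) * pderiv q)"
    unfolding r pderiv_mult pderiv_power_Suc by simp
  then show ?thesis by (simp add: dvd_smult)
qed

lemma higher_pderiv_power_dvd:
  fixes p :: "real poly"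
  assumes "q ^ (m + l) dvd p"
  shows "q ^ m dvd (pderiv ^^ l) p"
  using assms
proof (induction l arbitrary: m)
  case (Suc l)
  then have "q ^ Suc m dvd (pderiv ^^ l) p" by (metis add_Suc_shift add_Suc)
  then show ?case using pderiv_power_dvd by simp
qed simp

lemma poly_higher_pderiv_root:
  fixes p :: "real poly"
  assumes "[:-a, 1:] ^ m dvd p" "l < m"
  shows "poly ((pderiv ^^ l) p) a = 0"
proof -
  have "[:-a, 1:] ^ (1 + l) dvd [:-a, 1:] ^ m"
    using assms(2) by (intro le_imp_power_dvd) simp
  then have "[:-a, 1:] ^ (1 + l) dvd p" using assms(1) by (rule dvd_trans)
  then have "[:-a, 1:] ^ 1 dvd (pderiv ^^ l) p"
    by (rule higher_pderiv_power_dvd)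
  then show ?thesis by (simp add: poly_eq_0_iff_dvd)
qed

text \<open>
  Induction on \<open>m + n\<close>: multiply the identities for the exponents \<open>(m - 1, n)\<close> and \<open>(m, n - 1)\<close> by \<open>v\<close>
  and \<open>w\<close>, subtract, and divide by \<open>v - w\<close>.
\<close>
lemma power_bezout:
  fixes v w :: "real poly"
  assumes "v - w = [:2:]"
  shows "\<exists>A B. A * v ^ m + B * w ^ n = 1"
proof (induction "m + n" arbitrary: m n rule: less_induct)
  case less
  show ?case
  proof (cases "m = 0 \<or> n = 0")
    case True
    then show ?thesis
    proof
      assume "m = 0"
      then have "1 * v ^ m + 0 * w ^ n = 1" by simp
      then show ?thesis by blast
    next
      assume "n = 0"
      then have "0 * v ^ m + 1 * w ^ n = 1" by simp
      then show ?thesis by blast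
    qed
  next
    case False
    then obtain m' n' where mn: "m = Suc m'" "n = Suc n'" by (metis not0_implies_Suc)
    obtain A B where 1: "A * v ^ m' + B * w ^ n = 1" using less[of m' n] mn by auto
    obtain A' B' where 2: "A' * v ^ m + B' * w ^ n' = 1" using less[of m n'] mn by auto
    have "(A - w * A') * v ^ m + (v * B - B') * w ^ n
       = v * (A * v ^ m' + B * w ^ n) - w * (A' * v ^ m + B' * w ^ n')"
      unfolding mn by (simp add: algebra_simps)
    also have "\<dots> = [:2:]" using 1 2 assms by simp
    finally have "([:1/2:] * (A - w * A')) * v ^ m + ([:1/2:] * (v * B - B')) * w ^ n = [:1/2:] * [:2:]"
      by (simp add: algebra_simps flip: smult_add_right)
    then have "([:1/2:] * (A - w * A')) * v ^ m + ([:1/2:] * (v * B - B')) * w ^ n = 1"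
      by (simp add: one_pCons)
    then show ?thesis by blast
  qed
qed

text \<open>
  With a Bezout identity \<open>A * v ^ K + B * w ^ K = 1\<close> for the linear factors \<open>v\<close> and \<open>w\<close> of the two
  nodes, \<open>B * w ^ K\<close> equals \<open>1\<close> up to order \<open>K\<close> at the first node and \<open>0\<close> up to order \<open>K\<close> at the
  second, so multiplying it with \<open>v ^ i / fact i\<close> gives the basis polynomials.  The sign \<open>s\<close> selects
  the node on either side of \<open>a\<close>, so that one lemma serves both nodes.
\<close>
lemma hermite_basis:
  "\<exists>H. \<forall>i<K. \<forall>l<K. poly ((pderiv ^^ l) (H i)) a = (if l = i then 1 else 0) \<and>
     poly ((pderiv ^^ l) (H i)) (a + 2 * s) = (0 :: real)" if s: "s = 1 \<or> s = -1"
proof -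
  define v where "v = [:-a, 1:]"
  define w where "w = [:-(a + 2 * s), 1:]"
  have "\<exists>A B. A * v ^ K + B * w ^ K = 1"
  proof (cases "s = 1")
    case True
    then show ?thesis using power_bezout[of v w K K] by (simp add: v_def w_def)
  next
    case False
    then show ?thesis using power_bezout[of w v K K] s 
      by (metis (no_types, lifting) add.commute v_def w_def diff_pCons diff_self diff_minus_eq_add
          add_diff_cancel_left' minus_diff_eq mult_minus1_right right_minus_eq)
  qed
  then obtain A B where AB: "A * v ^ K + B * w ^ K = 1" by blast
  define H where "H i = B * w ^ K * smult (1 / fact i) (v ^ i)" for i
  have "poly ((pderiv ^^ l) (H i)) a = (if l = i then 1 else 0)" if "i < K" "l < K" for i l
  proof -
    have e: "H i = smult (1 / fact i) (v ^ i) + v ^ K * (- A * smult (1 / fact i) (v ^ i))"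
    proof -
      have "B * w ^ K * X = X + v ^ K * (- A * X)" for X
      proof -
        have "(A * v ^ K + B * w ^ K) * X = X" by (simp add: AB)
        then show ?thesis by (simp add: algebra_simps)
      qed
      then show ?thesis unfolding H_def .
    qed
    have z: "poly ((pderiv ^^ l) (v ^ K * (- A * smult (1 / fact i) (v ^ i)))) a = 0"
      by (rule poly_higher_pderiv_root[OF _ that(2)]) (simp only: v_def[symmetric] dvd_triv_left)
    have "poly ((pderiv ^^ l) (v ^ i)) a = (if l = i then fact i else 0)"
    proof -
      have d: "(pderiv ^^ l) (v ^ i) = smult (pochhammer (of_nat (Suc (i - l))) l) (v ^ (i - l))" if "l \<le> i"
        using that
      proof (induction l)
        case (Suc l)
        then obtain r where r: "i - l = Suc r" "i - Suc l = r" by (metis Suc_diff_Suc Suc_le_lessD)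
        have "(pderiv ^^ Suc l) (v ^ i) = smult (pochhammer (of_nat (Suc (Suc r))) l) (pderiv (v ^ Suc r))"
          using Suc r by (simp add: pderiv_smult)
        also have "pderiv (v ^ Suc r) = smult (of_nat (Suc r)) (v ^ r)"
          by (simp only: pderiv_power_Suc) (simp add: v_def pderiv_pCons)
        finally show ?case using r by (simp add: pochhammer_rec algebra_simps)
      qed simp
      show ?thesis
      proof (cases l i rule: linorder_cases)
        case less
        then have "poly (v ^ (i - l)) a = 0" by (simp add: v_def)
        then show ?thesis using d less by simp
      next
        case equal
        then show ?thesis using d by (simp add: pochhammer_fact flip: pochhammer_fact) 
      next
        case greater
        have "degree (v ^ i) \<le> i" unfolding v_def by (metis degree_linear_power order_refl)
        then have "(pderiv ^^ l) (v ^ i) = 0"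
          using greater by (intro poly_eqI) (simp add: coeff_higher_pderiv coeff_eq_0)
        then show ?thesis using greater by simp
      qed
    qed
    then show ?thesis
      unfolding e higher_pderiv_add higher_pderiv_smult poly_add using z by simp
  qed
  moreover have "poly ((pderiv ^^ l) (H i)) (a + 2 * s) = 0" if "i < K" "l < K" for i l
  proof (rule poly_higher_pderiv_root[OF _ that(2)])
    show "[:- (a + 2 * s), 1:] ^ K dvd H i"
      unfolding H_def w_def[symmetric] by (intro dvd_mult2 dvd_triv_right)
  qed
  ultimately show ?thesis by blast
qed

lemma poly_bounded_on_unit: "\<exists>C\<ge>0. \<forall>u. \<bar>u\<bar> \<le> 1 \<longrightarrow> \<bar>poly p u\<bar> \<le> (C::real)"
proof -
  have "bounded (poly p ` {-1..1})"
    by (intro compact_imp_bounded compact_continuous_image) (auto intro!: continuous_intros)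
  then obtain C where "\<forall>u\<in>{-1..1}. \<bar>poly p u\<bar> \<le> C"
    unfolding bounded_iff by auto
  then show ?thesis by (intro exI[of _ "max C 0"]) (auto simp: le_max_iff_disj abs_le_iff)
qed

text \<open>
  What matters is that the interpolating polynomial is small whenever the prescribed values are
  small: it is a combination of finitely many fixed polynomials with these values as
  coefficients.
\<close>
lemma hermite_interpolation:
  "\<exists>C\<ge>0. \<forall>e cp cm. (\<forall>l<K. \<bar>cp l\<bar> \<le> e \<and> \<bar>cm l\<bar> \<le> e) \<longrightarrow>
    (\<exists>Q::real poly. (\<forall>l<K. poly ((pderiv ^^ l) Q) 1 = cp l \<and> poly ((pderiv ^^ l) Q) (-1) = cm l) \<and>
      (\<forall>l\<le>K. \<forall>u. \<bar>u\<bar> \<le> 1 \<longrightarrow> \<bar>poly ((pderiv ^^ l) Q) u\<bar> \<le> C * e))"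
proof -
  obtain H where H: "\<And>i l. i < K \<Longrightarrow> l < K \<Longrightarrow> poly ((pderiv ^^ l) (H i)) 1 = (if l = i then 1 else 0) \<and>
     poly ((pderiv ^^ l) (H i)) (-1) = (0::real)"
    using hermite_basis[of "-1" K 1] by auto
  obtain G where G: "\<And>i l. i < K \<Longrightarrow> l < K \<Longrightarrow> poly ((pderiv ^^ l) (G i)) (-1) = (if l = i then 1 else 0) \<and>
     poly ((pderiv ^^ l) (G i)) 1 = (0::real)"
    using hermite_basis[of "1" K "-1"] by auto
  obtain b where b: "\<And>p. b p \<ge> 0" "\<And>p u. \<bar>u\<bar> \<le> 1 \<Longrightarrow> \<bar>poly p u\<bar> \<le> (b p::real)"
    using poly_bounded_on_unit by metis
  define C where "C = (\<Sum>l\<le>K. \<Sum>i<K. b ((pderiv ^^ l) (H i)) + b ((pderiv ^^ l) (G i)))"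
  have C0: "C \<ge> 0" unfolding C_def by (intro sum_nonneg add_nonneg_nonneg b)
  show ?thesis
  proof (intro exI[of _ C] conjI C0 allI impI)
    fix e :: real and cp cm :: "nat \<Rightarrow> real"
    assume c: "\<forall>l<K. \<bar>cp l\<bar> \<le> e \<and> \<bar>cm l\<bar> \<le> e"
    define Q where "Q = (\<Sum>i<K. smult (cp i) (H i) + smult (cm i) (G i))"
    have pQ: "poly ((pderiv ^^ l) Q) u
      = (\<Sum>i<K. cp i * poly ((pderiv ^^ l) (H i)) u + cm i * poly ((pderiv ^^ l) (G i)) u)" for l u
      unfolding Q_def by (simp add: higher_pderiv_sum higher_pderiv_add higher_pderiv_smult poly_sum)
    show "\<exists>Q::real poly. (\<forall>l<K. poly ((pderiv ^^ l) Q) 1 = cp l \<and> poly ((pderiv ^^ l) Q) (-1) = cm l) \<and>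
      (\<forall>l\<le>K. \<forall>u. \<bar>u\<bar> \<le> 1 \<longrightarrow> \<bar>poly ((pderiv ^^ l) Q) u\<bar> \<le> C * e)"
    proof (intro exI[of _ Q] conjI allI impI)
      fix l assume l: "l < K"
      have "poly ((pderiv ^^ l) Q) 1 = (\<Sum>i<K. if i = l then cp i else 0)"
        unfolding pQ by (intro sum.cong) (use l H G in auto)
      then show "poly ((pderiv ^^ l) Q) 1 = cp l" using l by simp
      have "poly ((pderiv ^^ l) Q) (-1) = (\<Sum>i<K. if i = l then cm i else 0)"
        unfolding pQ by (intro sum.cong) (use l H G in auto)
      then show "poly ((pderiv ^^ l) Q) (-1) = cm l" using l by simp
    next
      fix l u assume l: "l \<le> K" and u: "\<bar>u::real\<bar> \<le> 1"
      have "\<bar>poly ((pderiv ^^ l) Q) u\<bar>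
        \<le> (\<Sum>i<K. \<bar>cp i * poly ((pderiv ^^ l) (H i)) u + cm i * poly ((pderiv ^^ l) (G i)) u\<bar>)"
        unfolding pQ by (rule sum_abs)
      also have "\<dots> \<le> (\<Sum>i<K. (b ((pderiv ^^ l) (H i)) + b ((pderiv ^^ l) (G i))) * e)"
      proof (intro sum_mono)
        fix i assume i: "i \<in> {..<K}"
        have "\<bar>cp i * poly ((pderiv ^^ l) (H i)) u\<bar> \<le> e * b ((pderiv ^^ l) (H i))"
          unfolding abs_mult using c i b(2)[OF u] by (intro mult_mono) (auto intro: order_trans[OF abs_ge_zero])
        moreover have "\<bar>cm i * poly ((pderiv ^^ l) (G i)) u\<bar> \<le> e * b ((pderiv ^^ l) (G i))"
          unfolding abs_mult using c i b(2)[OF u] by (intro mult_mono) (auto intro: order_trans[OF abs_ge_zero])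
        ultimately show "\<bar>cp i * poly ((pderiv ^^ l) (H i)) u + cm i * poly ((pderiv ^^ l) (G i)) u\<bar>
          \<le> (b ((pderiv ^^ l) (H i)) + b ((pderiv ^^ l) (G i))) * e"
          by (simp add: algebra_simps)
      qed
      also have "\<dots> = (\<Sum>i<K. b ((pderiv ^^ l) (H i)) + b ((pderiv ^^ l) (G i))) * e"
        by (simp add: sum_distrib_right)
      also have "\<dots> \<le> C * e"
      proof (cases "K = 0")
        case False
        then have "e \<ge> 0" using c by (metis abs_ge_zero not_gr_zero order_trans)
        moreover have "(\<Sum>i<K. b ((pderiv ^^ l) (H i)) + b ((pderiv ^^ l) (G i))) \<le> C"
          unfolding C_def using l b(1)
          by (intro member_le_sum[of l "{..K}" "\<lambda>l. \<Sum>i<K. b ((pderiv ^^ l) (H i)) + b ((pderiv ^^ l) (G i))"])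
            (auto intro!: sum_nonneg add_nonneg_nonneg)
        ultimately show ?thesis by (intro mult_right_mono) auto
      qed (simp add: C_def)
      finally show "\<bar>poly ((pderiv ^^ l) Q) u\<bar> \<le> C * e" .
    qed
  qed
qed

section \<open>Taylor expansion and its correction at the ends of a window\<close>

lemma higher_deriv_near:
  assumes "times_differentiable_at (Suc m) g x"
  shows "((deriv ^^ m) g has_real_derivative (deriv ^^ Suc m) g x) (at x)"
    and "\<forall>\<^sub>F \<mu> in at_right 0. \<forall>y. \<bar>y - x\<bar> \<le> \<mu> \<longrightarrow>
      (\<forall>l<m. ((deriv ^^ l) g has_real_derivative (deriv ^^ Suc l) g y) (at y))"
proof -
  show "((deriv ^^ m) g has_real_derivative (deriv ^^ Suc m) g x) (at x)"
    using assms by (simp add: DERIV_deriv_iff_real_differentiable)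
  obtain d where d: "d > 0" "\<And>y. dist y x < d \<Longrightarrow> times_differentiable_at m g y"
    using assms by (auto simp: eventually_nhds_metric)
  have "((deriv ^^ l) g has_real_derivative (deriv ^^ Suc l) g y) (at y)"
    if "\<mu> < d" "\<bar>y - x\<bar> \<le> \<mu>" "l < m" for \<mu> y l
    using times_differentiable_atD[OF d(2) that(3), of y] that
    by (simp add: dist_real_def DERIV_deriv_iff_real_differentiable)
  then show "\<forall>\<^sub>F \<mu> in at_right 0. \<forall>y. \<bar>y - x\<bar> \<le> \<mu> \<longrightarrow>
      (\<forall>l<m. ((deriv ^^ l) g has_real_derivative (deriv ^^ Suc l) g y) (at y))"
    unfolding eventually_at_right_field using d(1) by blast
qed

definition taylor_poly :: "nat \<Rightarrow> (real \<Rightarrow> real) \<Rightarrow> real \<Rightarrow> real poly" where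
  "taylor_poly k g x0 = (\<Sum>i\<le>k. monom ((deriv ^^ i) g x0 / fact i) i)"

lemma coeff_taylor_poly:
  "coeff (taylor_poly k g x0) i = (if i \<le> k then (deriv ^^ i) g x0 / fact i else 0)"
  by (simp add: taylor_poly_def coeff_sum if_distrib cong: if_cong)

lemma taylor_poly_at_0:
  "l \<le> k \<Longrightarrow> poly ((pderiv ^^ l) (taylor_poly k g x0)) 0 = (deriv ^^ l) g x0"
  by (simp add: poly_0_coeff_0 coeff_higher_pderiv coeff_taylor_poly flip: pochhammer_fact)

lemma taylor_poly_top: "poly ((pderiv ^^ k) (taylor_poly k g x0)) t = (deriv ^^ k) g x0"
proof -
  have "(pderiv ^^ k) (taylor_poly k g x0) = [:(deriv ^^ k) g x0:]"
    by (intro poly_eqI)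
      (auto simp: coeff_higher_pderiv coeff_taylor_poly coeff_pCons simp flip: pochhammer_fact split: nat.split)
  then show ?thesis by simp
qed

lemma taylor_poly_deriv:
  "((\<lambda>x. poly ((pderiv ^^ l) T) (x - x0)) has_real_derivative poly ((pderiv ^^ Suc l) T) (x - x0)) (at x)"
  using DERIV_chain2[where f = "poly ((pderiv ^^ l) T)" and g = "\<lambda>x. x - x0" and x = x,
      OF poly_DERIV, of 1]
  by (auto intro!: derivative_eq_intros)

text \<open>
  For the derivative of order \<open>k - 1\<close> this is differentiability at \<open>x0\<close>.  Lower orders follow by
  descending induction, integrating the bound with the mean value inequality.
\<close>
lemma taylor_remainder:
  assumes "times_differentiable_at k g x0" "l < k" "0 < \<epsilon>"
  shows "\<forall>\<^sub>F \<mu> in at_right 0. \<forall>x. \<bar>x - x0\<bar> \<le> \<mu> \<longrightarrow>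
    \<bar>(deriv ^^ l) g x - poly ((pderiv ^^ l) (taylor_poly k g x0)) (x - x0)\<bar> \<le> \<epsilon> * \<bar>x - x0\<bar> ^ (k - l)"
proof -
  obtain m where k: "k = Suc m" using assms(2) by (cases k) auto
  define T where "T = taylor_poly k g x0"
  define e where "e l x = (deriv ^^ l) g x - poly ((pderiv ^^ l) T) (x - x0)" for l x
  note near = higher_deriv_near[OF assms(1)[unfolded k]]
  have e0: "e l x0 = 0" if "l \<le> k" for l
    using taylor_poly_at_0[OF that] by (simp add: e_def T_def)
  have "l \<le> m" using assms(2) k by simp
  then have "\<forall>\<^sub>F \<mu> in at_right 0. \<forall>x. \<bar>x - x0\<bar> \<le> \<mu> \<longrightarrow> \<bar>e l x\<bar> \<le> \<epsilon> * \<bar>x - x0\<bar> ^ (Suc m - l)"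
  proof (induction rule: inc_induct)
    case base
    have "(e m has_real_derivative 0) (at x0)"
      unfolding e_def using DERIV_diff[OF near(1) taylor_poly_deriv[of m T x0 x0]]
        taylor_poly_at_0[of "Suc m" k g x0] by (simp add: T_def k del: funpow.simps)
    then obtain d where d: "d > 0" "\<And>y. \<bar>y - x0\<bar> < d \<Longrightarrow> \<bar>e m y\<bar> \<le> \<epsilon> * \<bar>y - x0\<bar>"
      using assms(3) e0[of m] k
      unfolding has_field_derivative_def has_derivative_at_alt by auto
    then show ?case
      unfolding eventually_at_right_field by (intro exI[of _ d]) auto
  next
    case (step n)
    from step.IH near(2) show ?case
    proof eventually_elim
      case (elim \<mu>)
      show ?case
      proof (intro allI impI)
        fix x assume x: "\<bar>x - x0\<bar> \<le> \<mu>"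
        have "norm (e n x - e n x0) \<le> (\<epsilon> * \<bar>x - x0\<bar> ^ (Suc m - Suc n)) * norm (x - x0)"
        proof (rule field_differentiable_bound[of "cball x0 \<bar>x - x0\<bar>"])
          fix z assume z: "z \<in> cball x0 \<bar>x - x0\<bar>"
          then have z': "\<bar>z - x0\<bar> \<le> \<bar>x - x0\<bar>" by (simp add: dist_real_def abs_minus_commute)
          then have "((deriv ^^ n) g has_real_derivative (deriv ^^ Suc n) g z) (at z)"
            using elim(2) x step.hyps by auto
          then show "(e n has_field_derivative e (Suc n) z) (at z within cball x0 \<bar>x - x0\<bar>)"
            unfolding e_def
            by (rule has_field_derivative_at_within[OF DERIV_diff[OF _ taylor_poly_deriv]])
          have "\<bar>e (Suc n) z\<bar> \<le> \<epsilon> * \<bar>z - x0\<bar> ^ (Suc m - Suc n)"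
            using elim(1) x z' by auto
          also have "\<dots> \<le> \<epsilon> * \<bar>x - x0\<bar> ^ (Suc m - Suc n)"
            using z' assms(3) by (intro mult_left_mono power_mono) auto
          finally show "norm (e (Suc n) z) \<le> \<epsilon> * \<bar>x - x0\<bar> ^ (Suc m - Suc n)" by simp
        qed (auto simp: dist_real_def)
        also have "\<dots> = \<epsilon> * \<bar>x - x0\<bar> ^ Suc (Suc m - Suc n)" by simp
        also have "Suc (Suc m - Suc n) = Suc m - n" using step.hyps by simp
        finally show "\<bar>e n x\<bar> \<le> \<epsilon> * \<bar>x - x0\<bar> ^ (Suc m - n)"
          using e0[of n] step.hyps k by simp
      qed
    qed
  qed
  then show ?thesis by (simp add: e_def T_def k)
qed

text \<open>
  On the window of radius \<open>\<mu>\<close> the correction term is \<open>\<mu> ^ k\<close> times the derivative of \<open>Q\<close> at the scaled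
  point \<open>(x - x0) / \<mu>\<close>.  Interpolating one order higher than the density, that is, at the level of
  its antiderivative, turns the condition on the mass into a condition on the values \<open>Q 1\<close> and
  \<open>Q (-1)\<close>.  The data are the scaled Taylor remainders, hence as small as desired.
\<close>
lemma hermite_correction:
  fixes k :: nat and g :: "real \<Rightarrow> real" and x0 :: real
  defines "T \<equiv> taylor_poly k g x0"
  assumes g: "times_differentiable_at k g x0" and "0 < k" and x0: "0 < x0"
    and cont: "continuous_on {0<..} g" and "0 < \<epsilon>"
  shows "\<forall>\<^sub>F \<mu> in at_right 0. \<exists>Q::real poly.
    (\<forall>l<k. poly ((pderiv ^^ l) T) \<mu> + \<mu> ^ (k - l) * poly ((pderiv ^^ Suc l) Q) 1 = (deriv ^^ l) g (x0 + \<mu>)) \<and>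
    (\<forall>l<k. poly ((pderiv ^^ l) T) (- \<mu>) + \<mu> ^ (k - l) * poly ((pderiv ^^ Suc l) Q) (-1) = (deriv ^^ l) g (x0 - \<mu>)) \<and>
    \<mu> ^ (k + 1) * (poly Q 1 - poly Q (-1)) = integral {x0 - \<mu>..x0 + \<mu>} (\<lambda>x. g x - poly T (x - x0)) \<and>
    (\<forall>l\<le>Suc k. \<forall>u. \<bar>u\<bar> \<le> 1 \<longrightarrow> \<bar>poly ((pderiv ^^ l) Q) u\<bar> \<le> \<epsilon>)"
proof -
  obtain C where C: "C \<ge> 0" "\<And>e cp cm. (\<forall>l<Suc k. \<bar>cp l\<bar> \<le> e \<and> \<bar>cm l\<bar> \<le> e) \<Longrightarrow>
    (\<exists>Q::real poly. (\<forall>l<Suc k. poly ((pderiv ^^ l) Q) 1 = cp l \<and> poly ((pderiv ^^ l) Q) (-1) = cm l) \<and>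
      (\<forall>l\<le>Suc k. \<forall>u. \<bar>u\<bar> \<le> 1 \<longrightarrow> \<bar>poly ((pderiv ^^ l) Q) u\<bar> \<le> C * e))"
    using hermite_interpolation[of "Suc k"] by blast
  define d where "d = \<epsilon> / (C + 1)"
  have d: "d > 0" "C * d \<le> \<epsilon>" using \<open>0 < \<epsilon>\<close> C(1) by (auto simp: d_def field_simps)
  define e where "e l x = (deriv ^^ l) g x - poly ((pderiv ^^ l) T) (x - x0)" for l x
  have "\<forall>\<^sub>F \<mu> in at_right 0. \<forall>l\<in>{..<k}. \<forall>x. \<bar>x - x0\<bar> \<le> \<mu> \<longrightarrow> \<bar>e l x\<bar> \<le> d / 2 * \<bar>x - x0\<bar> ^ (k - l)"
    unfolding e_def T_def using d(1) by (intro eventually_ball_finite ballI taylor_remainder[OF g]) auto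
  moreover have "\<forall>\<^sub>F \<mu> in at_right 0. 0 < \<mu> \<and> \<mu> < x0"
    using x0 by (auto simp: eventually_at_right_field)
  ultimately show ?thesis
  proof eventually_elim
    case (elim \<mu>)
    have \<mu>: "0 < \<mu>" "\<mu> < x0" using elim by auto
    have el: "\<bar>e l x\<bar> \<le> d / 2 * \<mu> ^ (k - l)" if "l < k" "\<bar>x - x0\<bar> \<le> \<mu>" for l x
    proof -
      have "\<bar>e l x\<bar> \<le> d / 2 * \<bar>x - x0\<bar> ^ (k - l)" using elim(1) that by auto
      also have "\<dots> \<le> d / 2 * \<mu> ^ (k - l)" using that d by (intro mult_left_mono power_mono) auto
      finally show ?thesis .
    qed
    define I where "I = integral {x0 - \<mu>..x0 + \<mu>} (e 0)"
    define cp where "cp l = (case l of 0 \<Rightarrow> I / \<mu> ^ (k + 1) | Suc i \<Rightarrow> e i (x0 + \<mu>) / \<mu> ^ (k - i))" for l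
    define cm where "cm l = (case l of 0 \<Rightarrow> 0 | Suc i \<Rightarrow> e i (x0 - \<mu>) / \<mu> ^ (k - i))" for l
    have "continuous_on {x0 - \<mu>..x0 + \<mu>} (e 0)"
      unfolding e_def by (auto intro!: continuous_intros continuous_on_subset[OF cont] simp: \<mu>) (use \<mu> in linarith)
    then have "norm I \<le> integral {x0 - \<mu>..x0 + \<mu>} (\<lambda>x. d / 2 * \<mu> ^ k)"
      unfolding I_def using el[of 0] \<open>0 < k\<close>
      by (intro integral_norm_bound_integral integrable_continuous_real) (auto simp: abs_le_iff)
    then have I: "\<bar>I\<bar> \<le> d * \<mu> ^ (k + 1)" using \<mu> by (simp add: mult_ac)
    have quot: "\<bar>a / \<mu> ^ n\<bar> \<le> d" if "\<bar>a\<bar> \<le> d * \<mu> ^ n" for a n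
      using that \<mu>(1) by (simp only: abs_divide abs_of_pos zero_less_power pos_divide_le_eq)
    have "\<bar>cp l\<bar> \<le> d \<and> \<bar>cm l\<bar> \<le> d" if "l < Suc k" for l
    proof (cases l)
      case 0
      then show ?thesis using quot[OF I] d(1) by (simp add: cp_def cm_def)
    next
      case (Suc i)
      have "0 \<le> d * \<mu> ^ (k - i)" using d(1) \<mu>(1) by simp
      then have "\<bar>e i (x0 + \<mu>)\<bar> \<le> d * \<mu> ^ (k - i)" "\<bar>e i (x0 - \<mu>)\<bar> \<le> d * \<mu> ^ (k - i)"
        using el[of i "x0 + \<mu>"] el[of i "x0 - \<mu>"] that Suc \<mu>(1) by simp_all
      then show ?thesis using Suc quot by (simp add: cp_def cm_def)
    qed
    then obtain Q :: "real poly" where Q: "\<And>l. l < Suc k \<Longrightarrow> poly ((pderiv ^^ l) Q) 1 = cp l"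
      "\<And>l. l < Suc k \<Longrightarrow> poly ((pderiv ^^ l) Q) (-1) = cm l"
      "\<And>l u. l \<le> Suc k \<Longrightarrow> \<bar>u\<bar> \<le> 1 \<Longrightarrow> \<bar>poly ((pderiv ^^ l) Q) u\<bar> \<le> C * d"
      using C(2)[of cp d cm] by blast
    show ?case
    proof (intro exI[of _ Q] conjI allI impI)
      fix l assume l: "l < k"
      show "poly ((pderiv ^^ l) T) \<mu> + \<mu> ^ (k - l) * poly ((pderiv ^^ Suc l) Q) 1 = (deriv ^^ l) g (x0 + \<mu>)"
        using Q(1)[of "Suc l"] l \<mu> by (simp add: cp_def e_def del: funpow.simps)
      show "poly ((pderiv ^^ l) T) (- \<mu>) + \<mu> ^ (k - l) * poly ((pderiv ^^ Suc l) Q) (-1) = (deriv ^^ l) g (x0 - \<mu>)"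
        using Q(2)[of "Suc l"] l \<mu> by (simp add: cm_def e_def del: funpow.simps)
    next
      show "\<mu> ^ (k + 1) * (poly Q 1 - poly Q (-1)) = integral {x0 - \<mu>..x0 + \<mu>} (\<lambda>x. g x - poly T (x - x0))"
        using Q(1)[of 0] Q(2)[of 0] \<mu> by (simp add: cp_def cm_def I_def e_def[abs_def])
    next
      fix l u assume "l \<le> Suc k" "\<bar>u::real\<bar> \<le> 1"
      then show "\<bar>poly ((pderiv ^^ l) Q) u\<bar> \<le> \<epsilon>" using Q(3)[of l u] d(2) by linarith
    qed
  qed
qed

section \<open>The constants of the bound\<close>

text \<open>
  Multiplication by \<open>1 - x\<^sup>2\<close> turns this into Pascal's rule.  In particular no coefficient of order
  at most \<open>2 * m + 1\<close> vanishes, which is needed for the constants \<open>C_const k j\<close> and for the bumps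
  below, which have the same shape.
\<close>
lemma coeff_one_minus_square_power:
  "coeff ([:1, 0, -1:] ^ m * [:1, 1::real:]) n = (-1) ^ (n div 2) * real (m choose (n div 2))"
proof (induction m arbitrary: n)
  case 0
  consider "n = 0" | "n = 1" | i where "n = Suc (Suc i)" by (metis One_nat_def not0_implies_Suc)
  then show ?case by cases auto
next
  case (Suc m)
  define q where "q = [:1, 0, -1:] ^ m * [:1, 1::real:]"
  have e: "[:1, 0, -1:] ^ Suc m * [:1, 1::real:] = q + pCons 0 (pCons 0 (- q))"
    unfolding q_def power_Suc mult.assoc by (simp del: mult_pCons_right)
  have IH: "coeff q n = (-1) ^ (n div 2) * real (m choose (n div 2))" for n
    unfolding q_def by (rule Suc.IH)
  consider "n = 0" | "n = 1" | i where "n = Suc (Suc i)" by (metis One_nat_def not0_implies_Suc)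
  then show ?case
  proof cases
    case 3
    have "coeff ([:1, 0, -1:] ^ Suc m * [:1, 1::real:]) n = coeff q (Suc (Suc i)) - coeff q i"
      unfolding e 3 by simp
    then show ?thesis using IH[of "Suc (Suc i)"] IH[of i] 3
      by (simp add: algebra_simps)
  next
    case 1
    then show ?thesis unfolding e using IH[of 0] by simp
  next
    case 2
    then show ?thesis unfolding e using IH[of 1] by simp
  qed
qed

lemma poly_higher_pderiv_0: "poly ((pderiv ^^ l) p) 0 = fact l * coeff p l" for p :: "real poly"
  by (simp add: poly_0_coeff_0 coeff_higher_pderiv pochhammer_fact)

lemma C_const_eq:
  "C_const k j = fact j * ((-1) ^ (j div 2) * real ((k + 1) choose (j div 2)))"
proof -
  define p where "p = [:1, 0, -1:] ^ (k + 1) * [:1, 1::real:]"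
  have "(deriv ^^ j) (perturbation k) 0 = poly ((pderiv ^^ j) p) 0"
    by (rule higher_deriv_eqI[of UNIV _ "\<lambda>l. poly ((pderiv ^^ l) p)" j])
      (auto simp: perturbation_def p_def power2_eq_square algebra_simps intro!: poly_DERIV)
  then show ?thesis
    unfolding C_const_def p_def poly_higher_pderiv_0 coeff_one_minus_square_power .
qed

lemma d_const_pos:
  assumes "2 \<le> k" "j \<le> k - 1"
  shows "0 < d_const k j"
proof -
  have C: "C_const k i \<noteq> 0" if "i \<le> k" for i
    using that by (auto simp: C_const_eq)
  have "0 < lambda1 k j"
    using C[of j] C[of k] assms by (auto simp: lambda1_def)
  moreover have "0 < lambda2 k"
  proof -
    have "k choose (k div 2 - 1) > 0" "(k + 1) choose ((k - 1) div 2) > 0"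
      using assms by (auto simp del: binomial_Suc_Suc)
    moreover have "real ((2 * k + 3) * (k + 2)) > 0" by (simp only: of_nat_0_less_iff) simp
    ultimately show ?thesis
      unfolding lambda2_def
      by (auto intro!: mult_pos_pos divide_pos_pos zero_less_power
          simp del: binomial_Suc_Suc of_nat_mult of_nat_add)
  qed
  moreover have "0 < rate_exponent k j"
    using assms by (auto simp: rate_exponent_def intro!: divide_pos_pos)
  ultimately show ?thesis
    unfolding d_const_def by (intro mult_pos_pos divide_pos_pos) auto
qed

section \<open>Nested spikes\<close>

text \<open>
  One plus the sum of the first \<open>N\<close> terms is nonnegative and at least \<open>\<theta> ^ N\<close> on the interval of radius
  \<open>\<rho> ^ N\<close>, where the next term lives.  That term takes away at most half of \<open>\<theta> ^ N\<close>, and on the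
  interval of radius \<open>\<rho> ^ (N + 1)\<close> it adds at least \<open>(\<theta> - 1) * \<theta> ^ N\<close>.
\<close>
lemma spike_sum_nonneg:
  fixes z :: "real \<Rightarrow> real"
  assumes "1 < \<theta>" "0 < \<rho>" "\<rho> < 1"
    and supp: "\<And>u. 1 \<le> \<bar>u\<bar> \<Longrightarrow> z u = 0"
    and low: "\<And>u. - 1/2 \<le> z u"
    and high: "\<And>u. \<bar>u\<bar> \<le> \<rho> \<Longrightarrow> \<theta> - 1 \<le> z u"
  shows "0 \<le> 1 + (\<Sum>i<N. \<theta> ^ i * z (u / \<rho> ^ i))"
proof -
  define P where "P N u = 1 + (\<Sum>i<N. \<theta> ^ i * z (u / \<rho> ^ i))" for N u
  have "(\<forall>u. 0 \<le> P N u) \<and> (\<forall>u. \<bar>u\<bar> \<le> \<rho> ^ N \<longrightarrow> \<theta> ^ N \<le> P N u)"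
  proof (induction N)
    case 0
    then show ?case by (simp add: P_def)
  next
    case (Suc N)
    have S: "P (Suc N) u = P N u + \<theta> ^ N * z (u / \<rho> ^ N)" for u by (simp add: P_def)
    have t: "\<theta> ^ N > 0" using assms by simp
    have r: "\<rho> ^ N > 0" using assms by simp
    show ?case
    proof (intro conjI allI impI)
      fix u
      show "0 \<le> P (Suc N) u"
      proof (cases "\<bar>u\<bar> \<le> \<rho> ^ N")
        case True
        then have "\<theta> ^ N \<le> P N u" using Suc by blast
        moreover have "\<theta> ^ N * (- 1/2) \<le> \<theta> ^ N * z (u / \<rho> ^ N)"
          using low t by (intro mult_left_mono) auto
        ultimately show ?thesis unfolding S using t by simp
      next
        case False
        then have "1 \<le> \<bar>u / \<rho> ^ N\<bar>"
          using r by (simp only: abs_divide abs_of_pos le_divide_eq_1_pos)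
        then have "z (u / \<rho> ^ N) = 0" by (rule supp)
        then show ?thesis using Suc unfolding S by simp
      qed
    next
      fix u assume u: "\<bar>u\<bar> \<le> \<rho> ^ Suc N"
      also have "\<rho> ^ Suc N \<le> \<rho> ^ N" using assms by (intro power_decreasing) auto
      finally have "\<theta> ^ N \<le> P N u" using Suc by blast
      moreover have "\<theta> ^ N * (\<theta> - 1) \<le> \<theta> ^ N * z (u / \<rho> ^ N)"
      proof -
        have "\<bar>u / \<rho> ^ N\<bar> \<le> \<rho>"
          using u r by (simp only: abs_divide abs_of_pos pos_divide_le_eq power_Suc)
        then show ?thesis using high t by (intro mult_left_mono) auto
      qed
      ultimately show "\<theta> ^ Suc N \<le> P (Suc N) u"
        unfolding S by (simp add: algebra_simps)
    qed
  qed
  then show ?thesis by (simp add: P_def)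
qed

text \<open>
  The function \<open>Z 0\<close> is a multiple of \<open>(1 - u\<^sup>2) ^ (k + 2) * (1 + u)\<close>, cut off outside \<open>{-1..1}\<close>, and
  \<open>Z l\<close> is its \<open>l\<close>-th derivative.  The factor \<open>1 + u\<close> keeps the derivatives at \<open>0\<close> of order up to
  \<open>k + 1\<close> away from zero, whatever their parity; sign and size of the multiple make the derivative of order \<open>k + 1\<close>
  positive at \<open>0\<close> and bounded by \<open>1 / 2\<close>.  The bump for the density is \<open>Z 1\<close>, which has integral
  zero.
\<close>
lemma spike_exists:
  obtains Z :: "nat \<Rightarrow> real \<Rightarrow> real" and \<theta> \<rho> B :: real
  where "1 < \<theta>" "0 < \<rho>" "\<rho> < 1" "0 \<le> B"
    "\<And>l u. l \<le> k \<Longrightarrow> (Z l has_real_derivative Z (Suc l) u) (at u)"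
    "\<And>l u. l \<le> Suc k \<Longrightarrow> 1 \<le> \<bar>u\<bar> \<Longrightarrow> Z l u = 0"
    "\<And>l. l \<le> Suc k \<Longrightarrow> Z l 0 \<noteq> 0"
    "\<And>l u. l \<le> Suc k \<Longrightarrow> \<bar>Z l u\<bar> \<le> B"
    "\<And>N u. 0 \<le> 1 + (\<Sum>i<N. \<theta> ^ i * Z (Suc k) (u / \<rho> ^ i))"
proof -
  define q where "q = [:1, 0, -1:] ^ (k + 2) * [:1, 1::real:]"
  obtain b where b: "\<And>p. b p \<ge> 0" "\<And>p u. \<bar>u\<bar> \<le> 1 \<Longrightarrow> \<bar>poly p u\<bar> \<le> (b p::real)"
    using poly_bounded_on_unit by metis
  define b0 where "b0 = b ((pderiv ^^ Suc k) q)"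
  have q0: "poly ((pderiv ^^ l) q) 0 \<noteq> 0" if "l \<le> Suc k" for l
    unfolding q_def poly_higher_pderiv_0 coeff_one_minus_square_power using that by auto
  have fac: "[:1, 0, -1::real:] = [:-1, 1:] * [:-1, -1:]" "[:1, 0, -1::real:] = [:-(-1), 1:] * [:1, -1:]"
    by auto
  have qend: "poly ((pderiv ^^ l) q) 1 = 0" "poly ((pderiv ^^ l) q) (-1) = 0" if "l \<le> Suc k" for l
  proof -
    have "[:-1, 1:] ^ (k + 2) dvd q" "[:-(-1), 1:] ^ (k + 2) dvd q"
      unfolding q_def
      by (subst fac(1), simp only: power_mult_distrib mult.assoc dvd_triv_left)
        (subst fac(2), simp only: power_mult_distrib mult.assoc dvd_triv_left)
    then show "poly ((pderiv ^^ l) q) 1 = 0" "poly ((pderiv ^^ l) q) (-1) = 0"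
      using that by (intro poly_higher_pderiv_root[of _ "k + 2"]; simp)+
  qed
  \<comment> \<open>this scaling makes the derivative of order \<open>k + 1\<close> positive at \<open>0\<close> and at most \<open>1 / 2\<close> in size\<close>
  define c where "c = sgn (poly ((pderiv ^^ Suc k) q) 0) / (2 * (b0 + 1))"
  have b0: "b0 \<ge> 0" using b by (simp add: b0_def)
  have c0: "c \<noteq> 0" using q0[of "Suc k"] b0 by (auto simp: c_def sgn_if simp del: funpow.simps)
  have ca: "\<bar>c\<bar> = 1 / (2 * (b0 + 1))" using q0[of "Suc k"] b0 by (auto simp: c_def sgn_if simp del: funpow.simps)
  define R where "R = smult c q"
  define Z where "Z l u = (if u \<in> {-1..1} then poly ((pderiv ^^ l) R) u else 0)" for l u
  have Rend: "poly ((pderiv ^^ l) R) 1 = 0" "poly ((pderiv ^^ l) R) (-1) = 0" if "l \<le> Suc k" for l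
    using qend[OF that] by (auto simp: R_def higher_pderiv_smult)
  define r where "r = Z (Suc k) 0"
  have r: "r > 0"
  proof -
    have "r = c * poly ((pderiv ^^ Suc k) q) 0"
      unfolding r_def Z_def R_def higher_pderiv_smult by (simp del: funpow.simps)
    also have "\<dots> = \<bar>poly ((pderiv ^^ Suc k) q) 0\<bar> / (2 * (b0 + 1))"
      by (simp add: c_def abs_sgn mult.commute del: funpow.simps)
    finally show ?thesis using q0[of "Suc k"] b0 by (simp del: funpow.simps)
  qed
  have Zlow: "\<bar>Z (Suc k) u\<bar> \<le> 1/2" for u
  proof (cases "\<bar>u\<bar> \<le> 1")
    case True
    then have "\<bar>Z (Suc k) u\<bar> = \<bar>c\<bar> * \<bar>poly ((pderiv ^^ Suc k) q) u\<bar>"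
      unfolding Z_def R_def higher_pderiv_smult by (simp add: abs_mult abs_le_iff del: funpow.simps)
    also have "\<dots> \<le> \<bar>c\<bar> * b0" using b(2)[OF True] unfolding b0_def by (intro mult_left_mono) auto
    also have "\<dots> \<le> 1/2" using b0 by (simp add: ca field_simps)
    finally show ?thesis .
  qed (auto simp: Z_def)
  obtain d where d: "d > 0" "\<And>u. \<bar>u\<bar> < d \<Longrightarrow> r / 2 \<le> poly ((pderiv ^^ Suc k) R) u"
  proof -
    define f where "f = poly ((pderiv ^^ Suc k) R)"
    have fr: "f 0 = r" by (simp add: r_def Z_def f_def del: funpow.simps)
    have "isCont f 0" unfolding f_def by simp
    then have "\<exists>d>0. \<forall>u. u \<noteq> 0 \<and> norm (u - 0) < d \<longrightarrow> norm (f u - f 0) < r / 2"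
      using r unfolding isCont_def LIM_eq by (meson half_gt_zero)
    then obtain d where d: "d > 0" "\<And>u. u \<noteq> 0 \<Longrightarrow> \<bar>u\<bar> < d \<Longrightarrow> \<bar>f u - r\<bar> < r / 2"
      by (auto simp: fr)
    have "r / 2 \<le> f u" if "\<bar>u\<bar> < d" for u
    proof (cases "u = 0")
      case False
      then have "\<bar>f u - r\<bar> < r / 2" using d(2) that by blast
      then show ?thesis by linarith
    qed (use fr r in simp)
    then show thesis unfolding f_def by (rule that[OF d(1)])
  qed
  define \<rho> where "\<rho> = min d 1 / 2"
  define \<theta> where "\<theta> = 1 + r / 2"
  define B where "B = (\<Sum>l\<le>Suc k. b ((pderiv ^^ l) R))"
  have supp: "Z l u = 0" if "l \<le> Suc k" "1 \<le> \<bar>u\<bar>" for l u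
  proof (cases "u = 1 \<or> u = -1")
    case True
    then show ?thesis using Rend[OF that(1)] by (auto simp: Z_def)
  qed (use that in \<open>auto simp: Z_def\<close>)
  show ?thesis
  proof (rule that[of \<theta> \<rho> B Z])
    show tr: "1 < \<theta>" "0 < \<rho>" "\<rho> < 1" using r d(1) by (auto simp: \<theta>_def \<rho>_def)
    show B0: "0 \<le> B" unfolding B_def by (intro sum_nonneg b)
    show "(Z l has_real_derivative Z (Suc l) u) (at u)" if "l \<le> k" for l u
    proof -
      have "((\<lambda>y. if y \<in> {-1..1} then poly ((pderiv ^^ l) R) y else 0) has_real_derivative Z (Suc l) u) (at u)"
      proof (rule DERIV_glue_interval)
        show "(poly ((pderiv ^^ l) R) has_real_derivative Z (Suc l) u) (at u)" if "u \<in> {-1..1}"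
          using that poly_DERIV[of "(pderiv ^^ l) R" u] by (simp add: Z_def)
        show "((\<lambda>y. 0) has_real_derivative Z (Suc l) u) (at u)" if "u \<notin> {-1<..<1}"
          using supp[of "Suc l" u] that \<open>l \<le> k\<close> by (auto simp: abs_real_def split: if_splits)
      qed (use Rend[of l] that in auto)
      then show ?thesis by (simp add: Z_def[abs_def])
    qed
    show "Z l u = 0" if "l \<le> Suc k" "1 \<le> \<bar>u\<bar>" for l u by (rule supp[OF that])
    show "Z l 0 \<noteq> 0" if "l \<le> Suc k" for l
      using q0[OF that] c0 by (simp add: Z_def R_def higher_pderiv_smult)
    show "\<bar>Z l u\<bar> \<le> B" if "l \<le> Suc k" for l u
    proof (cases "\<bar>u\<bar> \<le> 1")
      case True
      have "\<bar>Z l u\<bar> \<le> b ((pderiv ^^ l) R)" using True b(2)[OF True, of "(pderiv ^^ l) R"] by (auto simp: Z_def abs_le_iff)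
      also have "\<dots> \<le> B" unfolding B_def using that b(1)
        by (intro member_le_sum[of l "{..Suc k}" "\<lambda>l. b ((pderiv ^^ l) R)"]) auto
      finally show ?thesis .
    next
      case False
      then show ?thesis using supp[OF that, of u] B0 by simp
    qed
    show "0 \<le> 1 + (\<Sum>i<N. \<theta> ^ i * Z (Suc k) (u / \<rho> ^ i))" for N u
    proof (rule spike_sum_nonneg[OF tr])
      show "- 1/2 \<le> Z (Suc k) u" for u using Zlow[of u] by (simp add: abs_le_iff)
      show "\<theta> - 1 \<le> Z (Suc k) u" if "\<bar>u\<bar> \<le> \<rho>" for u
      proof -
        have "\<bar>u\<bar> < d" "\<bar>u\<bar> \<le> 1" using that d(1) by (auto simp: \<rho>_def)
        then show ?thesis
          using d(2)[of u] by (simp add: \<theta>_def Z_def abs_le_iff del: funpow.simps)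
      qed
      show "Z (Suc k) u = 0" if "1 \<le> \<bar>u\<bar>" for u using supp[of "Suc k" u] that by simp
    qed
  qed
qed

text \<open>
  Each derivative of a function of \<open>(x - x0) / \<mu>\<close> costs one factor \<open>\<mu>\<close>; the powers of \<open>\<mu>\<close> in the
  families of derivatives below are arranged accordingly.
\<close>
lemma DERIV_scaled:
  fixes U :: "real \<Rightarrow> real"
  assumes "(U has_real_derivative V) (at ((x - x0) / \<mu>))" "\<mu> \<noteq> 0"
  shows "((\<lambda>x. \<mu> ^ Suc m * U ((x - x0) / \<mu>)) has_real_derivative \<mu> ^ m * V) (at x)"
proof -
  have "((\<lambda>x. (x - x0) / \<mu>) has_real_derivative 1 / \<mu>) (at x)"
    using assms(2) by (auto intro!: derivative_eq_intros)
  from DERIV_chain2[where f = U and g = "\<lambda>x. (x - x0) / \<mu>" and x = x, OF assms(1) this]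
  have "((\<lambda>x. \<mu> ^ Suc m * U ((x - x0) / \<mu>)) has_real_derivative \<mu> ^ Suc m * (V * (1 / \<mu>))) (at x)"
    by (rule DERIV_cmult)
  then show ?thesis using assms(2) by simp
qed

text \<open>
  The bumps are scaled so that the derivative of order \<open>k + 1\<close> of the \<open>i\<close>-th one has size \<open>\<theta> ^ i\<close>; the
  index \<open>l\<close> counts derivatives of the antiderivative of the perturbation, hence the shift by one.
\<close>
definition spike_sum :: "(nat \<Rightarrow> real \<Rightarrow> real) \<Rightarrow> real \<Rightarrow> real \<Rightarrow> nat \<Rightarrow> nat \<Rightarrow> nat \<Rightarrow> real \<Rightarrow> real" where
  "spike_sum Z \<theta> \<rho> k N l u = (\<Sum>i<N. \<theta> ^ i * ((\<rho> ^ i) ^ (Suc k - l) * Z l (u / \<rho> ^ i)))"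

lemma spike_sum_DERIV:
  assumes "0 < \<rho>" "l \<le> k" "\<And>u. (Z l has_real_derivative Z (Suc l) u) (at u)"
  shows "(spike_sum Z \<theta> \<rho> k N l has_real_derivative spike_sum Z \<theta> \<rho> k N (Suc l) u) (at u)"
proof -
  have "((\<lambda>u. \<theta> ^ i * ((\<rho> ^ i) ^ Suc (k - l) * Z l ((u - 0) / \<rho> ^ i))) has_real_derivative
      \<theta> ^ i * ((\<rho> ^ i) ^ (k - l) * Z (Suc l) (u / \<rho> ^ i))) (at u)" for i
    using assms by (intro DERIV_cmult DERIV_scaled) auto
  then have "((\<lambda>u. \<Sum>i<N. \<theta> ^ i * ((\<rho> ^ i) ^ Suc (k - l) * Z l ((u - 0) / \<rho> ^ i))) has_real_derivative
      (\<Sum>i<N. \<theta> ^ i * ((\<rho> ^ i) ^ (k - l) * Z (Suc l) (u / \<rho> ^ i)))) (at u)"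
    by (intro DERIV_sum) auto
  moreover have "Suc k - l = Suc (k - l)" "Suc k - Suc l = k - l" using assms(2) by auto
  ultimately show ?thesis unfolding spike_sum_def by (simp del: power_Suc)
qed

lemma spike_sum_supp:
  assumes "0 < \<rho>" "\<rho> < 1" "\<And>u. 1 \<le> \<bar>u\<bar> \<Longrightarrow> Z l u = 0" "1 \<le> \<bar>u\<bar>"
  shows "spike_sum Z \<theta> \<rho> k N l u = 0"
proof -
  have "Z l (u / \<rho> ^ i) = 0" for i
  proof (rule assms(3))
    have r: "0 < \<rho> ^ i" "\<rho> ^ i \<le> 1" using assms by (auto intro: power_le_one)
    then have "\<rho> ^ i \<le> \<bar>u\<bar>" using assms(4) by linarith
    then show "1 \<le> \<bar>u / \<rho> ^ i\<bar>"
      using r(1) by (simp only: abs_divide abs_of_pos le_divide_eq_1_pos)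
  qed
  then show ?thesis by (simp add: spike_sum_def)
qed

lemma spike_sum_bound:
  assumes "0 < \<rho>" "\<rho> < 1" "1 < \<theta>" "\<And>u. \<bar>Z l u\<bar> \<le> B"
  shows "\<bar>spike_sum Z \<theta> \<rho> k N l u\<bar> \<le> (\<Sum>i<N. \<theta> ^ i * B)"
  unfolding spike_sum_def
proof (rule order_trans[OF sum_abs sum_mono])
  fix i
  have r: "0 \<le> (\<rho> ^ i) ^ (Suc k - l)" "(\<rho> ^ i) ^ (Suc k - l) \<le> 1"
    using assms(1,2) by (auto intro!: power_le_one)
  have "\<bar>\<theta> ^ i * ((\<rho> ^ i) ^ (Suc k - l) * Z l (u / \<rho> ^ i))\<bar> = \<theta> ^ i * ((\<rho> ^ i) ^ (Suc k - l) * \<bar>Z l (u / \<rho> ^ i)\<bar>)"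
    using assms(1,3) by (simp add: abs_mult)
  also have "\<dots> \<le> \<theta> ^ i * (1 * B)"
    using assms(3,4) r by (intro mult_left_mono mult_mono) auto
  finally show "\<bar>\<theta> ^ i * ((\<rho> ^ i) ^ (Suc k - l) * Z l (u / \<rho> ^ i))\<bar> \<le> \<theta> ^ i * B" by simp
qed

section \<open>Two densities close to g0\<close>

text \<open>
  The family \<open>S\<close> stands for the nested spikes, in the units of \<open>a / 2\<close>: half of the \<open>k\<close>-th derivative
  \<open>a\<close> of the Taylor polynomial absorbs the Hermite correction, the other half the spikes.
\<close>
lemma k_monotone_density_local_alternative:
  fixes k :: nat and g0 :: "real \<Rightarrow> real" and x0 \<mu> a \<epsilon> :: real and T Q :: "real poly"
    and S :: "nat \<Rightarrow> real \<Rightarrow> real"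
  defines "s \<equiv> (-1) ^ k * (a / 2)"
  defines "F \<equiv> \<lambda>l x. poly ((pderiv ^^ l) T) (x - x0) +
    (\<mu> ^ (k - l) * poly ((pderiv ^^ Suc l) Q) ((x - x0) / \<mu>) + s * (\<mu> ^ (k - l) * S (Suc l) ((x - x0) / \<mu>)))"
  defines "g \<equiv> \<lambda>x. if x \<in> {x0 - \<mu>..x0 + \<mu>} then F 0 x else g0 x"
  assumes k: "2 \<le> k" and g0: "g0 \<in> k_monotone_densities k" and \<mu>: "0 < \<mu>" "\<mu> < x0"
    and der: "\<And>y l. \<bar>y - x0\<bar> \<le> \<mu> \<Longrightarrow> l < k - 1 \<Longrightarrow>
      ((deriv ^^ l) g0 has_real_derivative (deriv ^^ Suc l) g0 y) (at y)"
    and top: "\<And>t. (-1) ^ k * poly ((pderiv ^^ k) T) t = a" and a: "0 \<le> a" "\<epsilon> \<le> a / 2"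
    and right: "\<And>l. l < k \<Longrightarrow>
      poly ((pderiv ^^ l) T) \<mu> + \<mu> ^ (k - l) * poly ((pderiv ^^ Suc l) Q) 1 = (deriv ^^ l) g0 (x0 + \<mu>)"
    and left: "\<And>l. l < k \<Longrightarrow>
      poly ((pderiv ^^ l) T) (- \<mu>) + \<mu> ^ (k - l) * poly ((pderiv ^^ Suc l) Q) (-1) = (deriv ^^ l) g0 (x0 - \<mu>)"
    and mass: "\<mu> ^ (k + 1) * (poly Q 1 - poly Q (-1))
      = integral {x0 - \<mu>..x0 + \<mu>} (\<lambda>x. g0 x - poly T (x - x0))"
    and Q: "\<And>u. \<bar>u\<bar> \<le> 1 \<Longrightarrow> \<bar>poly ((pderiv ^^ Suc k) Q) u\<bar> \<le> \<epsilon>"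
    and S: "\<And>l u. l \<le> k \<Longrightarrow> (S l has_real_derivative S (Suc l) u) (at u)"
      "\<And>l u. l \<le> Suc k \<Longrightarrow> 1 \<le> \<bar>u\<bar> \<Longrightarrow> S l u = 0" "\<And>u. 0 \<le> 1 + S (Suc k) u"
  shows "g \<in> k_monotone_densities k"
    and "\<And>j. j \<le> k - 1 \<Longrightarrow> times_differentiable_at j g x0"
    and "\<And>j. j \<le> k - 1 \<Longrightarrow> (deriv ^^ j) g x0 = F j x0"
proof -
  have FD: "(F l has_real_derivative F (Suc l) x) (at x)" if "l < k" for l x
  proof -
    have e: "k - l = Suc (k - Suc l)" using that by simp
    show ?thesis
      unfolding F_def e using \<mu> S(1)[of "Suc l"] that poly_DERIV[of "(pderiv ^^ Suc l) Q"]
      by (intro DERIV_add DERIV_cmult DERIV_scaled taylor_poly_deriv) auto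
  qed
  have Fl: "F l (x0 - \<mu>) = (deriv ^^ l) g0 (x0 - \<mu>)" if "l < k" for l
    using left[OF that] S(2)[of "Suc l" "-1"] \<mu> that by (simp add: F_def del: funpow.simps)
  have Fr: "F l (x0 + \<mu>) = (deriv ^^ l) g0 (x0 + \<mu>)" if "l < k" for l
    using right[OF that] S(2)[of "Suc l" "1"] \<mu> that by (simp add: F_def del: funpow.simps)
  have k': "k - 2 < k - 1" "Suc (k - 2) = k - 1" "k - 1 < k" using k by auto
  have cont0: "continuous_on {x0 - \<mu>..x0 + \<mu>} g0"
  proof (rule continuous_on_subset)
    show "continuous_on {0<..} g0"
      using g0 by (intro k_monotone_continuous_on[of k]) (simp add: k_monotone_densities_def)
  qed (use \<mu> in auto)
  show "g \<in> k_monotone_densities k"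
    unfolding g_def
  proof (rule k_monotone_density_replace[OF k g0])
    show "0 < x0 - \<mu>" "x0 - \<mu> < x0 + \<mu>" using \<mu> by auto
    show "(F l has_real_derivative F (Suc l) x) (at x)" if "l < k" for l x by (rule FD[OF that])
    show "F l (x0 - \<mu>) = (deriv ^^ l) g0 (x0 - \<mu>)" if "l \<le> k - 2" for l using Fl that k by simp
    show "F l (x0 + \<mu>) = (deriv ^^ l) g0 (x0 + \<mu>)" if "l \<le> k - 2" for l using Fr that k by simp
    show "((deriv ^^ (k - 2)) g0 has_real_derivative F (k - 1) (x0 - \<mu>)) (at (x0 - \<mu>))"
      using der[of "x0 - \<mu>" "k - 2"] \<mu> k' Fl[of "k - 1"] by (simp del: funpow.simps)
    show "((deriv ^^ (k - 2)) g0 has_real_derivative F (k - 1) (x0 + \<mu>)) (at (x0 + \<mu>))"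
      using der[of "x0 + \<mu>" "k - 2"] \<mu> k' Fr[of "k - 1"] by (simp del: funpow.simps)
    show "0 \<le> (-1) ^ k * F k x" if x: "x \<in> {x0 - \<mu>..x0 + \<mu>}" for x
    proof -
      define u where "u = (x - x0) / \<mu>"
      have u: "\<bar>u\<bar> \<le> 1" using x \<mu> by (auto simp: u_def abs_le_iff divide_le_eq)
      have sq: "(-1) ^ k * ((-1) ^ k * y) = (y::real)" for y
        by (simp add: mult.assoc[symmetric] power_mult_distrib[symmetric])
      have "(-1) ^ k * F k x = a + (-1) ^ k * poly ((pderiv ^^ Suc k) Q) u + a / 2 * S (Suc k) u"
        using top[of "x - x0"] sq[of "a / 2 * S (Suc k) u"]
        by (simp add: F_def s_def u_def distrib_left mult.assoc del: funpow.simps)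
      moreover have "\<bar>(-1) ^ k * poly ((pderiv ^^ Suc k) Q) u\<bar> \<le> a / 2"
        using Q[OF u] a by (simp add: abs_mult del: funpow.simps)
      moreover have "0 \<le> a / 2 * (1 + S (Suc k) u)" using a S(3) by simp
      ultimately show ?thesis by (simp add: algebra_simps abs_le_iff del: funpow.simps)
    qed
    show "integral {x0 - \<mu>..x0 + \<mu>} (F 0) = integral {x0 - \<mu>..x0 + \<mu>} g0"
    proof -
      \<comment> \<open>correction and spikes together, with their antiderivative\<close>
      define E where "E x = \<mu> ^ k * poly (pderiv Q) ((x - x0) / \<mu>) + s * (\<mu> ^ k * S (Suc 0) ((x - x0) / \<mu>))" for x
      define H where "H x = \<mu> ^ Suc k * poly Q ((x - x0) / \<mu>) + s * (\<mu> ^ Suc k * S 0 ((x - x0) / \<mu>))" for x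
      have "(H has_real_derivative E x) (at x)" for x
        unfolding H_def E_def using \<mu> S(1)[of 0] poly_DERIV[of Q]
        by (intro DERIV_add DERIV_cmult DERIV_scaled) auto
      then have "(E has_integral (H (x0 + \<mu>) - H (x0 - \<mu>))) {x0 - \<mu>..x0 + \<mu>}"
        using \<mu> by (intro fundamental_theorem_of_calculus)
          (auto simp: has_real_derivative_iff_has_vector_derivative[symmetric] has_field_derivative_at_within)
      moreover have "H (x0 + \<mu>) - H (x0 - \<mu>) = \<mu> ^ (k + 1) * (poly Q 1 - poly Q (-1))"
        using S(2)[of 0 1] S(2)[of 0 "-1"] \<mu> by (simp add: H_def algebra_simps)
      ultimately have E: "(E has_integral integral {x0 - \<mu>..x0 + \<mu>} (\<lambda>x. g0 x - poly T (x - x0))) {x0 - \<mu>..x0 + \<mu>}"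
        using mass by simp
      have iT: "(\<lambda>x. poly T (x - x0)) integrable_on {x0 - \<mu>..x0 + \<mu>}"
        by (intro integrable_continuous_real continuous_intros)
      have ig: "g0 integrable_on {x0 - \<mu>..x0 + \<mu>}"
        by (intro integrable_continuous_real cont0)
      have "F 0 = (\<lambda>x. poly T (x - x0) + E x)" by (simp add: fun_eq_iff F_def E_def)
      then show ?thesis
        using integral_add[OF iT has_integral_integrable[OF E]] integral_diff[OF ig iT]
          integral_unique[OF E] by simp
    qed
  qed
  have gF: "g x = F 0 x" if "x \<in> {x0 - \<mu><..<x0 + \<mu>}" for x using that by (simp add: g_def)
  have x0: "x0 \<in> {x0 - \<mu><..<x0 + \<mu>}" using \<mu> by simp
  show "(deriv ^^ j) g x0 = F j x0" if "j \<le> k - 1" for j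
    by (rule higher_deriv_eqI[of "{x0 - \<mu><..<x0 + \<mu>}" g F "k - 1"]) (use that x0 gF FD k in auto)
  show "times_differentiable_at j g x0" if "j \<le> k - 1" for j
  proof (rule times_differentiable_atI[of "{x0 - \<mu><..<x0 + \<mu>}"])
    show "(deriv ^^ l) g differentiable at x" if "l < j" "x \<in> {x0 - \<mu><..<x0 + \<mu>}" for l x
      using higher_deriv_differentiableI[of "{x0 - \<mu><..<x0 + \<mu>}" g F "k - 1" l x] that gF FD \<open>j \<le> k - 1\<close>
      by (auto simp: real_differentiable_def)
  qed (use x0 in auto)
qed

text \<open>
  All requirements on the window, being satisfied by every sufficiently small radius \<open>\<mu>\<close>, hold
  together near zero.  The second density carries one more spike than the first, so their
  difference is that spike, supported on the radius \<open>\<mu> * \<rho> ^ N\<close>.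
\<close>
lemma two_local_alternatives:
  fixes k N :: nat and g0 :: "real \<Rightarrow> real" and x0 \<theta> \<rho> B :: real and Z :: "nat \<Rightarrow> real \<Rightarrow> real"
  defines "s \<equiv> (deriv ^^ k) g0 x0 / 2"
  assumes k: "2 \<le> k" and g0: "g0 \<in> k_monotone_densities k" and x0: "0 < x0"
    and diff: "times_differentiable_at k g0 x0"
    and a: "0 < (-1) ^ k * (deriv ^^ k) g0 x0" and b: "0 < g0 x0"
    and r: "1 < \<theta>" "0 < \<rho>" "\<rho> < 1"
    and Z: "\<And>l u. l \<le> k \<Longrightarrow> (Z l has_real_derivative Z (Suc l) u) (at u)"
      "\<And>l u. l \<le> Suc k \<Longrightarrow> 1 \<le> \<bar>u\<bar> \<Longrightarrow> Z l u = 0"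
      "\<And>l u. l \<le> Suc k \<Longrightarrow> \<bar>Z l u\<bar> \<le> B"
      "\<And>N u. 0 \<le> 1 + (\<Sum>i<N. \<theta> ^ i * Z (Suc k) (u / \<rho> ^ i))"
  shows "\<exists>K. \<forall>\<^sub>F \<mu> in at_right 0. \<mu> < x0 \<and> (\<exists>f g.
    f \<in> k_monotone_densities k \<and> g \<in> k_monotone_densities k \<and>
    (\<forall>x. x \<notin> {x0 - \<mu>..x0 + \<mu>} \<longrightarrow> f x = g0 x \<and> g x = g0 x) \<and>
    (\<forall>x\<in>{x0 - \<mu>..x0 + \<mu>}. \<bar>f x - g0 x\<bar> \<le> K * \<mu> ^ k \<and> \<bar>g x - g0 x\<bar> \<le> K * \<mu> ^ k \<and>
       g0 x0 / 2 \<le> g0 x \<and> g0 x0 / 2 \<le> f x) \<and>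
    (\<forall>x. g x - f x = s * (\<mu> * \<rho> ^ N) ^ k * \<theta> ^ N * Z 1 ((x - x0) / (\<mu> * \<rho> ^ N))) \<and>
    (\<forall>j\<le>k - 1. times_differentiable_at j f x0 \<and> times_differentiable_at j g x0 \<and>
       (deriv ^^ j) g x0 - (deriv ^^ j) f x0 = s * (\<mu> * \<rho> ^ N) ^ (k - j) * \<theta> ^ N * Z (Suc j) 0))"
proof -
  define T where "T = taylor_poly k g0 x0"
  define a where "a = (-1) ^ k * (deriv ^^ k) g0 x0"
  have a0: "0 < a" using assms by (simp add: a_def)
  have s: "s = (-1) ^ k * (a / 2)"
    by (simp add: s_def a_def mult.assoc[symmetric] power_mult_distrib[symmetric])
  have cont: "continuous_on {0<..} g0"
    using g0 by (intro k_monotone_continuous_on[of k]) (simp add: k_monotone_densities_def)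
  \<comment> \<open>the three summands bound the Taylor remainder, the Hermite correction and the spikes\<close>
  define K where "K = 1 + a / 2 + \<bar>s\<bar> * ((\<Sum>i<N. \<theta> ^ i * B) + (\<Sum>i<Suc N. \<theta> ^ i * B))"
  have B: "0 \<le> B" using Z(3)[of 0 0] by linarith
  have s0: "0 \<le> (\<Sum>i<M. \<theta> ^ i * B)" for M using B r by (intro sum_nonneg) auto
  obtain m where m: "k = Suc m" using k by (cases k) auto
  have ev1: "\<forall>\<^sub>F \<mu> in at_right 0. 0 < \<mu> \<and> \<mu> < x0"
    using x0 by (auto simp: eventually_at_right_field)
  have ev2: "\<forall>\<^sub>F \<mu> in at_right 0. \<forall>y. \<bar>y - x0\<bar> \<le> \<mu> \<longrightarrow>
      (\<forall>l<k - 1. ((deriv ^^ l) g0 has_real_derivative (deriv ^^ Suc l) g0 y) (at y))"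
    using higher_deriv_near(2)[of m g0 x0] diff by (simp add: m)
  have ev3: "\<forall>\<^sub>F \<mu> in at_right 0. \<forall>x. \<bar>x - x0\<bar> \<le> \<mu> \<longrightarrow> \<bar>g0 x - poly T (x - x0)\<bar> \<le> 1 * \<bar>x - x0\<bar> ^ k"
    using taylor_remainder[OF diff, of 0 1] k by (simp add: T_def)
  have ev4: "\<forall>\<^sub>F \<mu> in at_right 0. \<forall>x. \<bar>x - x0\<bar> \<le> \<mu> \<longrightarrow> \<bar>g0 x - g0 x0\<bar> < g0 x0 / 4"
  proof -
    have "isCont g0 x0" using cont x0 by (simp add: continuous_on_eq_continuous_at)
    then obtain d where "d > 0" "\<And>x. \<bar>x - x0\<bar> < d \<Longrightarrow> \<bar>g0 x - g0 x0\<bar> < g0 x0 / 4"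
      using b unfolding continuous_at_eps_delta by (metis dist_real_def zero_less_divide_iff zero_less_numeral)
    then show ?thesis unfolding eventually_at_right_field by (intro exI[of _ d]) auto
  qed
  have ev5: "\<forall>\<^sub>F \<mu> in at_right 0. K * \<mu> ^ k < g0 x0 / 4"
  proof -
    have "((\<lambda>\<mu>. K * \<mu> ^ k) \<longlongrightarrow> K * 0 ^ k) (at_right 0)" by (intro tendsto_intros)
    moreover have "(0::real) ^ k = 0" using k by simp
    ultimately show ?thesis using b by (intro order_tendstoD(2)[of _ 0]) auto
  qed
  have ev6: "\<forall>\<^sub>F \<mu> in at_right 0. \<exists>Q::real poly.
    (\<forall>l<k. poly ((pderiv ^^ l) T) \<mu> + \<mu> ^ (k - l) * poly ((pderiv ^^ Suc l) Q) 1 = (deriv ^^ l) g0 (x0 + \<mu>)) \<and>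
    (\<forall>l<k. poly ((pderiv ^^ l) T) (- \<mu>) + \<mu> ^ (k - l) * poly ((pderiv ^^ Suc l) Q) (-1) = (deriv ^^ l) g0 (x0 - \<mu>)) \<and>
    \<mu> ^ (k + 1) * (poly Q 1 - poly Q (-1)) = integral {x0 - \<mu>..x0 + \<mu>} (\<lambda>x. g0 x - poly T (x - x0)) \<and>
    (\<forall>l\<le>Suc k. \<forall>u. \<bar>u\<bar> \<le> 1 \<longrightarrow> \<bar>poly ((pderiv ^^ l) Q) u\<bar> \<le> a / 2)"
    unfolding T_def using k a0 by (intro hermite_correction[OF diff _ x0 cont]) auto
  from ev1 ev2 ev3 ev4 ev5 ev6
  have "\<forall>\<^sub>F \<mu> in at_right 0. \<mu> < x0 \<and> (\<exists>f g.
    f \<in> k_monotone_densities k \<and> g \<in> k_monotone_densities k \<and>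
    (\<forall>x. x \<notin> {x0 - \<mu>..x0 + \<mu>} \<longrightarrow> f x = g0 x \<and> g x = g0 x) \<and>
    (\<forall>x\<in>{x0 - \<mu>..x0 + \<mu>}. \<bar>f x - g0 x\<bar> \<le> K * \<mu> ^ k \<and> \<bar>g x - g0 x\<bar> \<le> K * \<mu> ^ k \<and>
       g0 x0 / 2 \<le> g0 x \<and> g0 x0 / 2 \<le> f x) \<and>
    (\<forall>x. g x - f x = s * (\<mu> * \<rho> ^ N) ^ k * \<theta> ^ N * Z 1 ((x - x0) / (\<mu> * \<rho> ^ N))) \<and>
    (\<forall>j\<le>k - 1. times_differentiable_at j f x0 \<and> times_differentiable_at j g x0 \<and>
       (deriv ^^ j) g x0 - (deriv ^^ j) f x0 = s * (\<mu> * \<rho> ^ N) ^ (k - j) * \<theta> ^ N * Z (Suc j) 0))"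
  proof eventually_elim
    case (elim \<mu>)
    have \<mu>: "0 < \<mu>" "\<mu> < x0" using elim(1) by auto
    obtain Q :: "real poly" where Q:
      "\<And>l. l < k \<Longrightarrow> poly ((pderiv ^^ l) T) \<mu> + \<mu> ^ (k - l) * poly ((pderiv ^^ Suc l) Q) 1 = (deriv ^^ l) g0 (x0 + \<mu>)"
      "\<And>l. l < k \<Longrightarrow> poly ((pderiv ^^ l) T) (- \<mu>) + \<mu> ^ (k - l) * poly ((pderiv ^^ Suc l) Q) (-1) = (deriv ^^ l) g0 (x0 - \<mu>)"
      "\<mu> ^ (k + 1) * (poly Q 1 - poly Q (-1)) = integral {x0 - \<mu>..x0 + \<mu>} (\<lambda>x. g0 x - poly T (x - x0))"
      "\<And>l u. l \<le> Suc k \<Longrightarrow> \<bar>u\<bar> \<le> 1 \<Longrightarrow> \<bar>poly ((pderiv ^^ l) Q) u\<bar> \<le> a / 2"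
      using elim(6) by blast
    define S where "S M = spike_sum Z \<theta> \<rho> k M" for M
    define F where "F M l x = poly ((pderiv ^^ l) T) (x - x0) +
      (\<mu> ^ (k - l) * poly ((pderiv ^^ Suc l) Q) ((x - x0) / \<mu>) + (-1) ^ k * (a / 2) * (\<mu> ^ (k - l) * S M (Suc l) ((x - x0) / \<mu>)))"
      for M l x
    define h where "h M x = (if x \<in> {x0 - \<mu>..x0 + \<mu>} then F M 0 x else g0 x)" for M x
    have S1: "(S M l has_real_derivative S M (Suc l) u) (at u)" if "l \<le> k" for M l u
      unfolding S_def by (rule spike_sum_DERIV) (use r Z(1) that in auto)
    have S2: "S M l u = 0" if "l \<le> Suc k" "1 \<le> \<bar>u\<bar>" for M l u
      unfolding S_def by (rule spike_sum_supp) (use r Z(2) that in auto)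
    have S3: "0 \<le> 1 + S M (Suc k) u" for M u
      using Z(4)[of u M] by (simp add: S_def spike_sum_def)
    have S4: "\<bar>S M l u\<bar> \<le> (\<Sum>i<M. \<theta> ^ i * B)" if "l \<le> Suc k" for M l u
      unfolding S_def by (rule spike_sum_bound) (use r Z(3) that in auto)
    have S5: "S (Suc N) l u - S N l u = \<theta> ^ N * ((\<rho> ^ N) ^ (Suc k - l) * Z l (u / \<rho> ^ N))" for l u
      by (simp add: S_def spike_sum_def)
    have top: "(-1) ^ k * poly ((pderiv ^^ k) T) t = a" for t
      by (simp add: T_def taylor_poly_top a_def)
    have der: "((deriv ^^ l) g0 has_real_derivative (deriv ^^ Suc l) g0 y) (at y)"
      if "\<bar>y - x0\<bar> \<le> \<mu>" "l < k - 1" for y l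
      using elim(2) that by blast
    have alt: "h M \<in> k_monotone_densities k" "j \<le> k - 1 \<Longrightarrow> times_differentiable_at j (h M) x0"
      "j \<le> k - 1 \<Longrightarrow> (deriv ^^ j) (h M) x0 = F M j x0" for M j
      unfolding h_def[abs_def] F_def[abs_def]
      by (rule k_monotone_density_local_alternative[where S = "S M", OF k g0 \<mu> der top
            less_imp_le[OF a0] order_refl Q(1-3) Q(4)[OF order_refl] S1 S2 S3]; assumption)+
    have Fdiff: "F (Suc N) l x - F N l x = s * (\<mu> * \<rho> ^ N) ^ (k - l) * \<theta> ^ N * Z (Suc l) ((x - x0) / (\<mu> * \<rho> ^ N))" for l x
    proof -
      have "F (Suc N) l x - F N l x = s * \<mu> ^ (k - l) * (S (Suc N) (Suc l) ((x - x0) / \<mu>) - S N (Suc l) ((x - x0) / \<mu>))"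
        by (simp add: F_def s algebra_simps del: funpow.simps)
      then show ?thesis unfolding S5 by (simp add: power_mult_distrib mult_ac)
    qed
    have close: "\<bar>h M x - g0 x\<bar> \<le> K * \<mu> ^ k" if M: "M = N \<or> M = Suc N" and x: "x \<in> {x0 - \<mu>..x0 + \<mu>}" for M x
    proof -
      define u where "u = (x - x0) / \<mu>"
      have u: "\<bar>u\<bar> \<le> 1" using x \<mu> by (auto simp: u_def abs_le_iff divide_le_eq)
      have xx: "\<bar>x - x0\<bar> \<le> \<mu>" using x by (auto simp: abs_le_iff)
      have 1: "\<bar>g0 x - poly T (x - x0)\<bar> \<le> \<mu> ^ k"
        using elim(3) xx power_mono[of "\<bar>x - x0\<bar>" \<mu> k] by fastforce
      have 2: "\<bar>\<mu> ^ k * poly (pderiv Q) u\<bar> \<le> \<mu> ^ k * (a / 2)"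
        unfolding abs_mult using Q(4)[of 1 u] u \<mu> by (intro mult_mono) auto
      have 3: "\<bar>s * (\<mu> ^ k * S M (Suc 0) u)\<bar> \<le> \<mu> ^ k * (\<bar>s\<bar> * ((\<Sum>i<N. \<theta> ^ i * B) + (\<Sum>i<Suc N. \<theta> ^ i * B)))"
      proof -
        have "\<bar>S M (Suc 0) u\<bar> \<le> (\<Sum>i<N. \<theta> ^ i * B) + (\<Sum>i<Suc N. \<theta> ^ i * B)"
          using M S4[of "Suc 0" M u] s0[of N] s0[of "Suc N"] by auto
        then have "\<mu> ^ k * (\<bar>s\<bar> * \<bar>S M (Suc 0) u\<bar>) \<le> \<mu> ^ k * (\<bar>s\<bar> * ((\<Sum>i<N. \<theta> ^ i * B) + (\<Sum>i<Suc N. \<theta> ^ i * B)))"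
          using \<mu> by (intro mult_left_mono) auto
        then show ?thesis using \<mu> by (simp add: abs_mult mult_ac)
      qed
      have "h M x - g0 x = - (g0 x - poly T (x - x0)) + \<mu> ^ k * poly (pderiv Q) u + s * (\<mu> ^ k * S M (Suc 0) u)"
        using x by (simp add: h_def F_def u_def s)
      also have "\<bar>\<dots>\<bar> \<le> \<mu> ^ k + \<mu> ^ k * (a / 2) + \<mu> ^ k * (\<bar>s\<bar> * ((\<Sum>i<N. \<theta> ^ i * B) + (\<Sum>i<Suc N. \<theta> ^ i * B)))"
        using 1 2 3 by linarith
      also have "\<dots> = K * \<mu> ^ k" by (simp only: K_def distrib_left distrib_right mult.commute)
      finally show ?thesis .
    qed
    show ?case
    proof (rule conjI[OF \<mu>(2)], rule exI[of _ "h N"], rule exI[of _ "h (Suc N)"],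
        intro conjI allI impI ballI)
      fix x
      have rN: "0 < \<rho> ^ N" "\<rho> ^ N \<le> 1" using r by (auto intro: power_le_one)
      show "h (Suc N) x - h N x = s * (\<mu> * \<rho> ^ N) ^ k * \<theta> ^ N * Z 1 ((x - x0) / (\<mu> * \<rho> ^ N))"
      proof (cases "x \<in> {x0 - \<mu>..x0 + \<mu>}")
        case True
        then show ?thesis using Fdiff[of 0 x] by (simp add: h_def)
      next
        case False
        then have "\<mu> \<le> \<bar>x - x0\<bar>" by (auto simp: abs_real_def)
        moreover have "\<mu> * \<rho> ^ N \<le> \<mu>" using rN \<mu> by (simp add: mult_left_le)
        ultimately have "\<mu> * \<rho> ^ N \<le> \<bar>x - x0\<bar>" by linarith
        then have "1 \<le> \<bar>(x - x0) / (\<mu> * \<rho> ^ N)\<bar>"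
          using mult_pos_pos[OF \<mu>(1) rN(1)] by (simp only: abs_divide abs_of_pos le_divide_eq_1_pos)
        then have "Z 1 ((x - x0) / (\<mu> * \<rho> ^ N)) = 0" using Z(2)[of 1] by simp
        then show ?thesis unfolding h_def if_not_P[OF False] by simp
      qed
    next
      fix x assume x: "x \<in> {x0 - \<mu>..x0 + \<mu>}"
      then have "\<bar>g0 x - g0 x0\<bar> < g0 x0 / 4" using elim(4) by (auto simp: abs_le_iff)
      moreover have "\<bar>h N x - g0 x\<bar> \<le> K * \<mu> ^ k" using close[of N x] x by blast
      ultimately show "g0 x0 / 2 \<le> g0 x" "g0 x0 / 2 \<le> h N x" using elim(5) b by linarith+
    next
      fix j assume j: "j \<le> k - 1"
      show "(deriv ^^ j) (h (Suc N)) x0 - (deriv ^^ j) (h N) x0 = s * (\<mu> * \<rho> ^ N) ^ (k - j) * \<theta> ^ N * Z (Suc j) 0"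
        using alt(3)[OF j] Fdiff[of j x0] by simp
    qed (use alt \<mu> close in \<open>auto simp: h_def\<close>)
  qed
  then show ?thesis by blast
qed

section \<open>Divergence of the local minimax risk\<close>

text \<open>
  The signed derivative of order \<open>k - 2\<close> is convex, so that of order \<open>k - 1\<close>, which exists near \<open>x0\<close>,
  is nondecreasing.
\<close>
lemma top_derivative_sign:
  assumes k: "2 \<le> k" and g: "k_monotone k g" and x0: "0 < x0"
    and diff: "times_differentiable_at k g x0"
  shows "0 \<le> (-1) ^ k * (deriv ^^ k) g x0"
proof -
  obtain m where m: "k = Suc (Suc m)" using k by (metis Suc_le_D numeral_2_eq_2 Suc_le_mono)
  define f where "f x = (-1) ^ k * (deriv ^^ m) g x" for x
  define f' where "f' x = (-1) ^ k * (deriv ^^ Suc m) g x" for x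
  have "convex_on {0<..} (\<lambda>x. (-1) ^ m * (deriv ^^ m) g x)"
    using g m unfolding k_monotone_def by simp
  then have conv: "convex_on {0<..} f" by (simp add: f_def[abs_def] m)
  note near = higher_deriv_near[OF diff[unfolded m]]
  have "\<forall>\<^sub>F \<mu> in at_right 0. 0 < \<mu> \<and> \<mu> < x0"
    using x0 by (auto simp: eventually_at_right_field)
  with near(2) have "\<forall>\<^sub>F \<mu> in at_right 0. (\<forall>y. \<bar>y - x0\<bar> \<le> \<mu> \<longrightarrow>
      (\<forall>l<Suc m. ((deriv ^^ l) g has_real_derivative (deriv ^^ Suc l) g y) (at y))) \<and> 0 < \<mu> \<and> \<mu> < x0"
    by eventually_elim blast
  then obtain \<mu> where \<mu>: "0 < \<mu>" "\<mu> < x0"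
    "\<And>y. \<bar>y - x0\<bar> \<le> \<mu> \<Longrightarrow> ((deriv ^^ m) g has_real_derivative (deriv ^^ Suc m) g y) (at y)"
    using eventually_happens'[OF trivial_limit_at_right_real] by (metis (no_types, lifting) lessI)
  have d: "(f has_real_derivative f' y) (at y)" if "\<bar>y - x0\<bar> \<le> \<mu>" for y
    unfolding f_def f'_def by (rule DERIV_cmult[OF \<mu>(3)[OF that]])
  have "0 \<le> (-1) ^ k * (deriv ^^ Suc (Suc m)) g x0"
  proof (rule mono_on_imp_deriv_nonneg)
    show "(f' has_real_derivative (-1) ^ k * (deriv ^^ Suc (Suc m)) g x0) (at x0)"
      unfolding f'_def by (rule DERIV_cmult[OF near(1)])
    show "x0 \<in> interior {x0 - \<mu>..x0 + \<mu>}" using \<mu> by simp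
    show "mono_on {x0 - \<mu>..x0 + \<mu>} f'"
    proof (rule mono_onI)
      fix y z assume yz: "y \<in> {x0 - \<mu>..x0 + \<mu>}" "z \<in> {x0 - \<mu>..x0 + \<mu>}" "y \<le> z"
      then have "\<bar>y - x0\<bar> \<le> \<mu>" "\<bar>z - x0\<bar> \<le> \<mu>" "0 < y" "0 < z" using \<mu> by (auto simp: abs_le_iff)
      then have "f y + f' y * (z - y) \<le> f z" "f z + f' z * (y - z) \<le> f y"
        using convex_on_tangent[OF conv d] by auto
      then have "0 \<le> (f' z - f' y) * (z - y)" by (simp add: algebra_simps)
      then show "f' y \<le> f' z" using yz by (cases "y = z") (auto simp: zero_le_mult_iff)
    qed
  qed
  then show ?thesis by (simp only: m)
qed

lemma one_plus_half_over_n_power: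
  assumes "0 < n"
  shows "(1 + 1 / (2 * real n)) ^ n \<le> 2"
proof -
  have "(1 + 1 / (2 * real n)) ^ n \<le> exp (1 / (2 * real n)) ^ n"
    by (intro power_mono exp_ge_add_one_self) auto
  also have "\<dots> = exp (1 / 2)" using assms by (simp add: exp_of_nat_mult[symmetric])
  also have "\<dots> \<le> 2"
  proof (rule power2_le_imp_le)
    have "(exp (1 / 2 :: real))\<^sup>2 = exp 1" by (simp add: power2_eq_square mult_exp_exp)
    then show "(exp (1 / 2 :: real))\<^sup>2 \<le> 2\<^sup>2" using exp_le by simp
  qed simp
  finally show ?thesis .
qed

text \<open>
  With \<open>N\<close> nested spikes on a window of radius \<open>\<mu>\<close> and \<open>R = \<mu> * \<rho> ^ N\<close>, the chi-square distance of the
  two densities is at most \<open>V * \<theta> ^ (2 * N) * R ^ (2 * k + 1)\<close>.  Equating it to \<open>1 / (2 * n)\<close> fixes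
  \<open>R\<close>, and the difference of the functionals, which is proportional to \<open>\<theta> ^ N * R ^ (k - j)\<close>, becomes
  a constant times \<open>\<theta> powr ((1 - 2 * \<alpha>) * N)\<close> divided by the rate \<open>n powr \<alpha>\<close>.  As \<open>1 - 2 * \<alpha>\<close> is
  positive, \<open>N\<close> can be chosen for any target \<open>c\<close>.  The radius \<open>\<tau>\<close> has to be large for large \<open>N\<close>, but
  it does not depend on \<open>n\<close>.
\<close>
lemma minimax_risk_unbounded:
  fixes k j :: nat and g0 :: "real \<Rightarrow> real" and x0 c :: real
  assumes k: "2 \<le> k" and g0: "g0 \<in> k_monotone_densities k" and x0: "0 < x0"
    and diff: "times_differentiable_at k g0 x0" and j: "j \<le> k - 1"
    and a: "0 < (-1) ^ k * (deriv ^^ k) g0 x0" and pos: "0 < g0 x0"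
  shows "\<exists>\<tau>>0. \<forall>\<^sub>F n in sequentially. ennreal c \<le>
    ennreal (real n powr rate_exponent k j) * minimax_risk_L1 n (derivative_functional j x0)
       (hellinger_ball k g0 n \<tau> \<inter> derivative_functional_domain j x0)"
proof -
  define b where "b = g0 x0"
  define s where "s = (deriv ^^ k) g0 x0 / 2"
  define \<alpha> where "\<alpha> = rate_exponent k j"
  have b0: "0 < b" using pos by (simp add: b_def)
  have s0: "s \<noteq> 0" using a by (auto simp: s_def)
  have \<alpha>: "\<alpha> = real (k - j) / (2 * real k + 1)"
    using j k by (simp add: \<alpha>_def rate_exponent_def of_nat_diff)
  have \<alpha>2: "0 < 1 - 2 * \<alpha>" using j by (simp add: \<alpha> field_simps of_nat_diff)
  obtain Z :: "nat \<Rightarrow> real \<Rightarrow> real" and \<theta> \<rho> B where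
    r: "1 < \<theta>" "0 < \<rho>" "\<rho> < 1" and B0: "0 \<le> B"
    and Z12: "\<And>l u. l \<le> k \<Longrightarrow> (Z l has_real_derivative Z (Suc l) u) (at u)"
      "\<And>l u. l \<le> Suc k \<Longrightarrow> 1 \<le> \<bar>u\<bar> \<Longrightarrow> Z l u = 0"
    and Z0: "\<And>l. l \<le> Suc k \<Longrightarrow> Z l 0 \<noteq> 0"
    and Z34: "\<And>l u. l \<le> Suc k \<Longrightarrow> \<bar>Z l u\<bar> \<le> B"
      "\<And>N u. 0 \<le> 1 + (\<Sum>i<N. \<theta> ^ i * Z (Suc k) (u / \<rho> ^ i))"
    by (rule spike_exists[of k]) (rule that)
  note Z = Z12 Z34
  have B: "0 < B" using Z(3)[of 0 0] Z0[of 0] by simp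
  define V where "V = 4 * s\<^sup>2 * B\<^sup>2 / b"
  have V: "0 < V" using b0 s0 B by (simp add: V_def)
  define L where "L = \<bar>s\<bar> * \<bar>Z (Suc j) 0\<bar> / 4 * (2 * V) powr (- \<alpha>)"
  have L: "0 < L" using s0 V Z0[of "Suc j"] j k by (simp add: L_def)
  define \<phi> where "\<phi> = \<theta> powr (1 - 2 * \<alpha>)"
  have \<phi>: "1 < \<phi>" using r \<alpha>2 by (simp add: \<phi>_def)
  obtain N where N: "c / L < \<phi> ^ N" using real_arch_pow[OF \<phi>] by blast
  \<comment> \<open>the reciprocal of \<open>R n ^ (2 * k + 1)\<close>, for which the chi-square bound is \<open>1 / (2 * n)\<close>\<close>
  define X where "X n = real n * (2 * V * \<theta> ^ (2 * N))" for n
  define R where "R n = X n powr (- 1 / (2 * real k + 1))" for n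
  define \<mu> where "\<mu> n = R n / \<rho> ^ N" for n
  have const: "0 < 2 * V * \<theta> ^ (2 * N)" using V r by simp
  have Xpos: "0 < X n" if "0 < n" for n using const that by (simp add: X_def)
  have "filterlim X at_top sequentially"
    unfolding X_def using const
    by (intro filterlim_at_top_mult_tendsto_pos[OF tendsto_const _ filterlim_real_sequentially])
  then have "(R \<longlongrightarrow> 0) sequentially"
    unfolding R_def by (intro tendsto_neg_powr) (simp_all add: field_simps)
  then have "(\<mu> \<longlongrightarrow> 0 / \<rho> ^ N) sequentially"
    unfolding \<mu>_def using r by (intro tendsto_intros) auto
  moreover have "\<forall>\<^sub>F n in sequentially. 0 < \<mu> n"
    using eventually_gt_at_top[of 0]
  proof eventually_elim
    case (elim n)
    then show ?case using Xpos[OF elim] r by (simp add: \<mu>_def R_def)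
  qed
  ultimately have lim: "filterlim \<mu> (at_right 0) sequentially"
    by (intro tendsto_imp_filterlim_at_right) auto
  obtain K where K: "\<forall>\<^sub>F \<mu> in at_right 0. \<mu> < x0 \<and> (\<exists>f g.
    f \<in> k_monotone_densities k \<and> g \<in> k_monotone_densities k \<and>
    (\<forall>x. x \<notin> {x0 - \<mu>..x0 + \<mu>} \<longrightarrow> f x = g0 x \<and> g x = g0 x) \<and>
    (\<forall>x\<in>{x0 - \<mu>..x0 + \<mu>}. \<bar>f x - g0 x\<bar> \<le> K * \<mu> ^ k \<and> \<bar>g x - g0 x\<bar> \<le> K * \<mu> ^ k \<and>
       b / 2 \<le> g0 x \<and> b / 2 \<le> f x) \<and>
    (\<forall>x. g x - f x = s * (\<mu> * \<rho> ^ N) ^ k * \<theta> ^ N * Z 1 ((x - x0) / (\<mu> * \<rho> ^ N))) \<and>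
    (\<forall>j\<le>k - 1. times_differentiable_at j f x0 \<and> times_differentiable_at j g x0 \<and>
       (deriv ^^ j) g x0 - (deriv ^^ j) f x0 = s * (\<mu> * \<rho> ^ N) ^ (k - j) * \<theta> ^ N * Z (Suc j) 0))"
    using two_local_alternatives[OF k g0 x0 diff a pos r Z, of N] unfolding s_def b_def by blast
  \<comment> \<open>the summand \<open>1\<close> only makes \<open>\<tau>\<close> positive\<close>
  define \<tau> where "\<tau> = 2 * K\<^sup>2 / b / (2 * V * \<theta> ^ (2 * N) * (\<rho> ^ N) ^ (2 * k + 1)) + 1"
  have "0 \<le> 2 * K\<^sup>2 / b / (2 * V * \<theta> ^ (2 * N) * (\<rho> ^ N) ^ (2 * k + 1))"
    using b0 V r by simp
  then have \<tau>: "0 < \<tau>" by (simp add: \<tau>_def)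
  have "\<forall>\<^sub>F n in sequentially. ennreal c \<le>
    ennreal (real n powr \<alpha>) * minimax_risk_L1 n (derivative_functional j x0)
       (hellinger_ball k g0 n \<tau> \<inter> derivative_functional_domain j x0)"
    using eventually_gt_at_top[of 0] eventually_compose_filterlim[OF K lim]
  proof eventually_elim
    case (elim n)
    have n: "0 < n" by fact
    have Rpos: "0 < R n" using Xpos[OF n] by (simp add: R_def)
    have rN: "0 < \<rho> ^ N" "\<rho> ^ N \<le> 1" using r by (auto intro: power_le_one)
    have \<mu>0: "0 < \<mu> n" using Rpos rN by (simp add: \<mu>_def)
    have \<mu>R: "\<mu> n * \<rho> ^ N = R n" using r(2) by (simp add: \<mu>_def)
    have R\<mu>: "R n \<le> \<mu> n" using rN Rpos by (simp add: \<mu>_def pos_le_divide_eq mult_left_le)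
    have Rpow: "R n ^ (2 * k + 1) = 1 / X n"
    proof -
      have "R n ^ (2 * k + 1) = X n powr (- 1 / (2 * real k + 1) * real (2 * k + 1))"
        unfolding R_def using Xpos[OF n] by (subst powr_power) (auto simp: mult.commute)
      also have "- 1 / (2 * real k + 1) * real (2 * k + 1) = - 1"
        by (simp add: field_simps)
      finally show ?thesis using Xpos[OF n] by (simp add: powr_minus_divide)
    qed
    have Rkj: "R n ^ (k - j) = X n powr (- \<alpha>)"
    proof -
      have "R n ^ (k - j) = X n powr (- 1 / (2 * real k + 1) * real (k - j))"
        unfolding R_def using Xpos[OF n] by (subst powr_power) (auto simp: mult.commute)
      then show ?thesis by (simp add: \<alpha>)
    qed
    from elim(2) obtain f g where fg: "f \<in> k_monotone_densities k" "g \<in> k_monotone_densities k"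
      and off: "\<forall>x. x \<notin> {x0 - \<mu> n..x0 + \<mu> n} \<longrightarrow> f x = g0 x \<and> g x = g0 x"
      and on: "\<forall>x\<in>{x0 - \<mu> n..x0 + \<mu> n}. \<bar>f x - g0 x\<bar> \<le> K * \<mu> n ^ k \<and> \<bar>g x - g0 x\<bar> \<le> K * \<mu> n ^ k \<and>
        b / 2 \<le> g0 x \<and> b / 2 \<le> f x"
      and gf: "\<forall>x. g x - f x = s * (\<mu> n * \<rho> ^ N) ^ k * \<theta> ^ N * Z 1 ((x - x0) / (\<mu> n * \<rho> ^ N))"
      and at0: "\<forall>j\<le>k - 1. times_differentiable_at j f x0 \<and> times_differentiable_at j g x0 \<and>
        (deriv ^^ j) g x0 - (deriv ^^ j) f x0 = s * (\<mu> n * \<rho> ^ N) ^ (k - j) * \<theta> ^ N * Z (Suc j) 0"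
      by (elim conjE exE) (rule that; assumption)
    have f_off: "f x = g0 x" and g_off: "g x = g0 x" if "x \<notin> {x0 - \<mu> n..x0 + \<mu> n}" for x
      using off that by blast+
    have f_close: "\<bar>f x - g0 x\<bar> \<le> K * \<mu> n ^ k" and g_close: "\<bar>g x - g0 x\<bar> \<le> K * \<mu> n ^ k"
      and g0_low: "b / 2 \<le> g0 x" and f_low: "b / 2 \<le> f x" if "x \<in> {x0 - \<mu> n..x0 + \<mu> n}" for x
      using bspec[OF on that] by blast+
    have gf: "g x - f x = s * R n ^ k * \<theta> ^ N * Z 1 ((x - x0) / R n)" for x
      using gf unfolding \<mu>R by blast
    have dom0: "times_differentiable_at j f x0" "times_differentiable_at j g x0"
      and dj: "(deriv ^^ j) g x0 - (deriv ^^ j) f x0 = s * R n ^ (k - j) * \<theta> ^ N * Z (Suc j) 0"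
      using at0[rule_format, OF j] unfolding \<mu>R by blast+
    have \<mu>x: "\<mu> n < x0" using elim(2) by blast
    have hell: "h \<in> hellinger_ball k g0 n \<tau>"
      if h: "h \<in> k_monotone_densities k" "\<And>x. x \<notin> {x0 - \<mu> n..x0 + \<mu> n} \<Longrightarrow> h x = g0 x"
        "\<And>x. x \<in> {x0 - \<mu> n..x0 + \<mu> n} \<Longrightarrow> \<bar>h x - g0 x\<bar> \<le> K * \<mu> n ^ k" for h
    proof -
      have "hellinger_sq h g0 \<le> ((x0 + \<mu> n) - (x0 - \<mu> n)) * (K * \<mu> n ^ k)\<^sup>2 / (2 * (b / 2))"
        using h g0_low b0 \<mu>0 k_monotone_nonneg
        by (intro hellinger_sq_le_local) (auto simp: k_monotone_densities_def)
      also have "\<dots> = 2 * K\<^sup>2 / b * \<mu> n ^ (2 * k + 1)"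
      proof -
        have "(x0 + \<mu> n) - (x0 - \<mu> n) = 2 * \<mu> n" "(K * \<mu> n ^ k)\<^sup>2 = K\<^sup>2 * \<mu> n ^ (2 * k)"
          by (simp_all add: power_mult_distrib power_even_eq)
        then show ?thesis by simp
      qed
      also have "\<mu> n ^ (2 * k + 1) = 1 / X n / (\<rho> ^ N) ^ (2 * k + 1)"
        unfolding \<mu>_def power_divide Rpow ..
      also have "2 * K\<^sup>2 / b * (1 / X n / (\<rho> ^ N) ^ (2 * k + 1)) = (\<tau> - 1) / real n"
        by (simp add: \<tau>_def X_def mult_ac)
      also have "\<dots> \<le> \<tau> / real n" by (intro divide_right_mono) auto
      finally show ?thesis using h(1) by (simp add: hellinger_ball_def)
    qed
    define D where "D = \<bar>s\<bar> * R n ^ k * \<theta> ^ N * B"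
    define v where "v = 1 + ((x0 + R n) - (x0 - R n)) * D\<^sup>2 / (b / 2)"
    have v: "v = 1 + 1 / (2 * real n)"
    proof -
      have "((x0 + R n) - (x0 - R n)) * D\<^sup>2 / (b / 2) = V * \<theta> ^ (2 * N) * R n ^ (2 * k + 1)"
      proof -
        have "(x0 + R n) - (x0 - R n) = 2 * R n"
          "D\<^sup>2 = s\<^sup>2 * R n ^ (2 * k) * \<theta> ^ (2 * N) * B\<^sup>2"
          by (simp_all add: D_def power_mult_distrib power_even_eq)
        then show ?thesis by (simp add: V_def)
      qed
      also have "\<dots> = 1 / (2 * real n)"
        unfolding Rpow X_def using const n V r by (simp add: field_simps)
      finally show ?thesis by (simp add: v_def)
    qed
    obtain L' where L': "L' \<in> borel_measurable borel" "\<And>x. 0 \<le> L' x"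
      "density_law g = density (density_law f) (\<lambda>x. ennreal (L' x))"
      "(\<integral>\<^sup>+x. ennreal ((L' x)\<^sup>2) \<partial>density_law f) \<le> ennreal v"
      unfolding v_def
    proof (rule local_likelihood_ratio[OF fg(1,2)])
      show "0 < x0 - R n" "x0 - R n \<le> x0 + R n" "0 < b / 2" using R\<mu> \<mu>x Rpos b0 by auto
      fix x
      show "g x = f x" if "x \<notin> {x0 - R n..x0 + R n}"
      proof -
        have "R n \<le> \<bar>x - x0\<bar>" using that by (auto simp: abs_real_def)
        then have "1 \<le> \<bar>(x - x0) / R n\<bar>"
          using Rpos by (simp only: abs_divide abs_of_pos le_divide_eq_1_pos)
        then show ?thesis using gf[of x] Z(2)[of 1] by simp
      qed
      show "\<bar>g x - f x\<bar> \<le> D"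
        unfolding gf D_def abs_mult using Rpos r Z(3)[of 1]
        by (intro mult_mono) auto
      show "b / 2 \<le> f x" if "x \<in> {x0 - R n..x0 + R n}"
        using f_low[of x] that R\<mu> by auto
    qed (rule that[unfolded v_def])
    have v2: "0 \<le> v" "v ^ n \<le> 2" unfolding v using one_plus_half_over_n_power[OF n] by auto
    have dom: "f \<in> hellinger_ball k g0 n \<tau> \<inter> derivative_functional_domain j x0"
      "g \<in> hellinger_ball k g0 n \<tau> \<inter> derivative_functional_domain j x0"
      using hell[OF fg(1) f_off f_close] hell[OF fg(2) g_off g_close] dom0 by (auto simp: derivative_functional_domain_def)
    have risk: "ennreal (\<bar>derivative_functional j x0 f - derivative_functional j x0 g\<bar> / 4)
      \<le> minimax_risk_L1 n (derivative_functional j x0) (hellinger_ball k g0 n \<tau> \<inter> derivative_functional_domain j x0)"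
      by (rule minimax_risk_L1_two_points[OF dom prob_space_density_law[OF fg(1)]
            prob_space_density_law[OF fg(2)] L' v2])
    have "c \<le> L * \<phi> ^ N" using N L by (simp add: divide_less_eq mult.commute)
    also have "L * \<phi> ^ N = real n powr \<alpha> * (\<bar>derivative_functional j x0 f - derivative_functional j x0 g\<bar> / 4)"
    proof -
      have "\<bar>derivative_functional j x0 f - derivative_functional j x0 g\<bar> = \<bar>s\<bar> * R n ^ (k - j) * \<theta> ^ N * \<bar>Z (Suc j) 0\<bar>"
        using arg_cong[OF dj, of abs] Rpos r
        by (simp add: derivative_functional_def abs_minus_commute abs_mult)
      also have "R n ^ (k - j) = real n powr (- \<alpha>) * (2 * V) powr (- \<alpha>) * (\<theta> ^ (2 * N)) powr (- \<alpha>)"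
        unfolding Rkj X_def using V r by (simp add: powr_mult mult.assoc)
      finally have "real n powr \<alpha> * (\<bar>derivative_functional j x0 f - derivative_functional j x0 g\<bar> / 4)
        = (real n powr \<alpha> * real n powr (- \<alpha>)) * L * (\<theta> ^ N * (\<theta> ^ (2 * N)) powr (- \<alpha>))"
        by (simp add: L_def)
      also have "real n powr \<alpha> * real n powr (- \<alpha>) = 1"
        using n by (simp add: powr_add[symmetric])
      also have "\<theta> ^ N * (\<theta> ^ (2 * N)) powr (- \<alpha>) = \<phi> ^ N"
      proof -
        have "\<theta> ^ N * (\<theta> ^ (2 * N)) powr (- \<alpha>) = \<theta> powr real N * (\<theta> powr real (2 * N)) powr (- \<alpha>)"
          using r by (simp only: powr_realpow)
        also have "\<dots> = \<theta> powr ((1 - 2 * \<alpha>) * real N)"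
          by (simp add: powr_powr powr_add[symmetric] algebra_simps)
        also have "\<dots> = \<phi> ^ N"
          unfolding \<phi>_def using r by (subst powr_power) (auto simp: mult.commute)
        finally show ?thesis .
      qed
      finally show ?thesis by simp
    qed
    finally have "ennreal c \<le> ennreal (real n powr \<alpha> * (\<bar>derivative_functional j x0 f - derivative_functional j x0 g\<bar> / 4))"
      by (rule ennreal_leI)
    also have "\<dots> = ennreal (real n powr \<alpha>) * ennreal (\<bar>derivative_functional j x0 f - derivative_functional j x0 g\<bar> / 4)"
      by (intro ennreal_mult) auto
    also have "\<dots> \<le> ennreal (real n powr \<alpha>) * minimax_risk_L1 n (derivative_functional j x0)
       (hellinger_ball k g0 n \<tau> \<inter> derivative_functional_domain j x0)"
      by (intro mult_left_mono risk) simp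
    finally show ?case .
  qed
  then show ?thesis using \<tau> unfolding \<alpha>_def by blast
qed

theorem proposition4p1:
  fixes k j :: nat and g0 :: "real \<Rightarrow> real" and x0 :: real
  assumes "2 \<le> k"
    and "g0 \<in> k_monotone_densities k"
    and "0 < x0"
    and "times_differentiable_at k g0 x0"
    and "j \<le> k - 1"
  shows "0 < d_const k j \<and>
    (SUP \<tau>\<in>{0::real<..}. liminf (\<lambda>n.
        ennreal (real n powr rate_exponent k j) *
        minimax_risk_L1 n (derivative_functional j x0)
          (hellinger_ball k g0 n \<tau> \<inter> derivative_functional_domain j x0)))
    \<ge> ennreal ((\<bar>(deriv ^^ k) g0 x0\<bar> ^ (2 * j + 1) * g0 x0 ^ (k - j)) powr (1 / (2 * real k + 1))
               * d_const k j)"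
proof (intro conjI d_const_pos assms)
  let ?c = "(\<bar>(deriv ^^ k) g0 x0\<bar> ^ (2 * j + 1) * g0 x0 ^ (k - j)) powr (1 / (2 * real k + 1)) * d_const k j"
  let ?r = "\<lambda>\<tau> n. ennreal (real n powr rate_exponent k j) *
        minimax_risk_L1 n (derivative_functional j x0)
          (hellinger_ball k g0 n \<tau> \<inter> derivative_functional_domain j x0)"
  have mono: "k_monotone k g0" using assms(2) by (simp add: k_monotone_densities_def)
  show "ennreal ?c \<le> (SUP \<tau>\<in>{0<..}. liminf (?r \<tau>))"
  proof (cases "(deriv ^^ k) g0 x0 = 0 \<or> g0 x0 = 0")
    case True
    then have c: "?c = 0" using assms(1,5) by auto
    show ?thesis unfolding c by simp
  next
    case False
    have "(-1) ^ k * (deriv ^^ k) g0 x0 \<noteq> 0" using False by simp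
    then have "0 < (-1) ^ k * (deriv ^^ k) g0 x0"
      using top_derivative_sign[OF assms(1) mono assms(3,4)] by linarith
    moreover have "0 < g0 x0" using k_monotone_nonneg[OF mono assms(3)] False by simp
    ultimately obtain \<tau> where "0 < \<tau>" "\<forall>\<^sub>F n in sequentially. ennreal ?c \<le> ?r \<tau> n"
      using minimax_risk_unbounded[OF assms, of ?c] by blast
    then show ?thesis by (intro SUP_upper2[of \<tau>] Liminf_bounded) auto
  qed
qed

end
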